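(* Let $S(y,z)\equiv S(x;y,z)$ be the formal power series in $x$ (with coefficients polynomial in $y,z$) that solves $$S(y,z)=xyz+\frac{xyz}{1-y}\bigl(S(1,z)-S(y,z)\bigr)+\frac{xyz}{z-y}\bigl(S(y,z)-S(y,y)\bigr).$$ Then $S(1+a,1+a)$, as a series in $x$ and $a$, is D-finite, and hence the generating function $S(1,1)=\sum_{n\geq 1}SB_n\,x^n$ of semi-Baxter permutations is also D-finite.
   Context: $SB_n$ is the number of semi-Baxter permutations of size $n$, i.e. permutations $\pi$ of $\{1,\dots,n\}$ with no indices $i<j$ and $k>j+1$ such that $\pi_{j+1}<\pi_i<\pi_k<\pi_j$. The series $S(y,z)$ is the generating function of semi-Baxter permutations in which $x$ marks the size and $y$ and $z$ mark two further statistics. A series $F(\mathbf{x})$, $\mathbf{x}=(x_1,\dots,x_k)$, is D-finite if for each $i=1,\dots,k$ it satisfies a nontrivial linear partial differential equation $Q_{i,0}(\mathbf{x})F+Q_{i,1}(\mathbf{x})\frac{\partial F}{\partial x_i}+\dots+Q_{i,r_i}(\mathbf{x})\frac{\partial^{r_i}F}{\partial x_i^{r_i}}=0$ with polynomial coefficients $Q_{i,j}$ (not all zero for fixed $i$). *)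

theory Defs
  imports "HOL-Computational_Algebra.Computational_Algebra" "HOL-Combinatorics.Permutations"
begin

definition semi_baxter :: "nat \<Rightarrow> (nat \<Rightarrow> nat) \<Rightarrow> bool" where
  "semi_baxter n \<pi> \<longleftrightarrow> \<pi> permutes {1..n} \<and>
     \<not> (\<exists>i j k. 1 \<le> i \<and> i < j \<and> j + 1 < k \<and> k \<le> n \<and>
          \<pi> (j + 1) < \<pi> i \<and> \<pi> i < \<pi> k \<and> \<pi> k < \<pi> j)"

definition SB :: "nat \<Rightarrow> nat" where
  "SB n = card {\<pi>. semi_baxter n \<pi>}"

text \<open>The sum starts at size 1, so the empty permutation is not counted.\<close>

definition SB_gf :: "rat fps" where
  "SB_gf = Abs_fps (\<lambda>n. if n = 0 then 0 else of_nat (SB n))"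

text \<open>
  A series in \<open>x\<close> with coefficients in \<open>\<rat>[y,z]\<close> has type \<open>rat poly poly fps\<close>; the outer
  polynomial variable is \<open>y\<close>, the inner one is \<open>z\<close>. The substitution \<open>y := u\<close>, \<open>z := v\<close> takes
  values in a commutative ring whose structure map from the rationals is \<open>\<iota>\<close>.
\<close>

definition subst_yz ::
  "(rat \<Rightarrow> 'b::comm_ring_1) \<Rightarrow> rat poly poly fps \<Rightarrow> 'b \<Rightarrow> 'b \<Rightarrow> 'b fps" where
  "subst_yz \<iota> S u v =
     Abs_fps (\<lambda>n. poly (map_poly (\<lambda>q. poly (map_poly \<iota> q) v) (fps_nth S n)) u)"

text \<open>
  The equation is read in \<open>\<rat>(y,z)[[x]]\<close>, where \<open>1 - y\<close> and \<open>z - y\<close> are invertible.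
\<close>

definition semi_baxter_equation :: "rat poly poly fps \<Rightarrow> bool" where
  "semi_baxter_equation S \<longleftrightarrow>
     (let y = Fraction_Field.Fract [:0, 1:] 1 :: rat poly poly fract;
          z = Fraction_Field.Fract [:[:0, 1:]:] 1;
          S' = subst_yz (\<lambda>c. Fraction_Field.Fract [:[:c:]:] 1) S
      in S' y z = fps_const (y * z) * fps_X
           + fps_const (y * z / (1 - y)) * fps_X * (S' 1 z - S' y z)
           + fps_const (y * z / (z - y)) * fps_X * (S' y z - S' y y))"

definition S_one_one :: "rat poly poly fps \<Rightarrow> rat fps" where
  "S_one_one S = subst_yz (\<lambda>c. c) S 1 1"

text \<open>
  Series in \<open>x\<close> and \<open>a\<close> have type \<open>rat fps fps\<close>, with \<open>x\<close> the outer and \<open>a\<close> the inner variable;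
  here \<open>[:1, 1:]\<close> is \<open>1 + a\<close>.
\<close>

definition S_one_plus_a :: "rat poly poly fps \<Rightarrow> rat fps fps" where
  "S_one_plus_a S =
     Abs_fps (\<lambda>n. fps_of_poly (fps_nth (subst_yz (\<lambda>c. [:c:]) S [:1, 1:] [:1, 1:]) n))"

text \<open>
  One linear differential equation: \<open>emb\<close> embeds the polynomials into the series ring and \<open>D\<close> is
  the partial derivative with respect to the variable concerned.
\<close>

definition satisfies_linear_de ::
  "('p::zero \<Rightarrow> 's::comm_ring_1) \<Rightarrow> ('s \<Rightarrow> 's) \<Rightarrow> 's \<Rightarrow> bool" where
  "satisfies_linear_de emb D F \<longleftrightarrow>
     (\<exists>r (Q :: nat \<Rightarrow> 'p). (\<exists>j\<le>r. Q j \<noteq> 0) \<and> (\<Sum>j\<le>r. emb (Q j) * (D ^^ j) F) = 0)"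

definition d_finite :: "'a::field_char_0 fps \<Rightarrow> bool" where
  "d_finite F \<longleftrightarrow> satisfies_linear_de fps_of_poly fps_deriv F"

definition fps2_of_poly2 :: "'a::field_char_0 poly poly \<Rightarrow> 'a fps fps" where
  "fps2_of_poly2 q = fps_of_poly (map_poly fps_of_poly q)"

definition fps_deriv_inner :: "'a::field_char_0 fps fps \<Rightarrow> 'a fps fps" where
  "fps_deriv_inner F = Abs_fps (\<lambda>n. fps_deriv (fps_nth F n))"

definition d_finite2 :: "'a::field_char_0 fps fps \<Rightarrow> bool" where
  "d_finite2 F \<longleftrightarrow>
     satisfies_linear_de fps2_of_poly2 fps_deriv F \<and>
     satisfies_linear_de fps2_of_poly2 fps_deriv_inner F"

end

theory Submission
  imports Defs
begin

text \<open>
  Appending a last value to semi-Baxter permutations gives a generating tree in which a permutation is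
  labelled by the number \<open>h\<close> of admissible values below and the number \<open>k\<close> of admissible values above
  its last entry (\<open>sum_children\<close>). Summing \<open>y^h * z^k\<close> over the permutations of size \<open>n\<close> therefore gives
  the coefficients of a solution of the functional equation (\<open>sb_weight_functional\<close>), which is the only
  one because the equation is a recursion in the exponent of \<open>x\<close>. In particular \<open>S(1, 1)\<close> counts
  semi-Baxter permutations.

  For D-finiteness the kernel method is applied. If \<open>y = 1 + \<alpha>\<close> and \<open>z = \<zeta>\<close> are series in \<open>x\<close> at which the
  coefficient of \<open>S(y, z)\<close> vanishes, then \<open>S(1, \<zeta>)\<close> and \<open>S(1 + \<alpha>, 1 + \<alpha>)\<close> are linearly related
  (\<open>kernel_method\<close>). A chain of five such pairs leads from \<open>S(1 + a, 1 + a)\<close> to \<open>S(1, 1 + 1/a)\<close> and shows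
  that
  \<open>S(1 + a, 1 + a) + x * (1 + a)^2 / a^4 * S(1, 1 + 1/a)\<close>
  is a combination of \<open>1\<close> and of one algebraic series \<open>V\<close>, a root of a quadratic equation, with
  coefficients in \<open>\<rat>[x, a, 1/a]\<close> (\<open>orbit_relation\<close>). The second term has only negative powers of \<open>a\<close>, so
  \<open>S(1 + a, 1 + a)\<close> is the nonnegative part in \<open>a\<close> of this combination, and \<open>S(1, 1)\<close> is its constant
  coefficient in \<open>a\<close>.

  Nonnegative parts and coefficients are controlled by finite-dimensional spaces. The linear
  differential equation of \<open>V\<close> in \<open>a\<close> (\<open>root_ode_a\<close>) is a recurrence for the coefficients of \<open>V\<close> at powers
  of \<open>a\<close>, so these span, together with \<open>1\<close>, a space of finite dimension over \<open>\<rat>(x)\<close>. A second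
  differential equation (\<open>root_ode_x\<close>) expresses the derivative of \<open>V\<close> by \<open>x\<close> through \<open>V\<close> and its
  derivative by \<open>a\<close>, with a denominator free of \<open>a\<close>; hence this space is closed under differentiation
  by \<open>x\<close>. Multiplication by a polynomial commutes with taking nonnegative parts up to finitely many of
  those coefficients (\<open>nonneg_mult\<close>), so adding the nonnegative part of \<open>V\<close> yields a space of finite
  dimension over \<open>\<rat>(x, a)\<close> that is closed under both partial derivatives. The elements of such spaces
  are D-finite, because sufficiently many successive derivatives are linearly dependent
  (\<open>ratspan_satisfies_linear_de\<close>).
\<close>

section \<open>The generating tree of semi-Baxter permutations\<close>

text \<open>
  Every permutation of size \<open>n + 1\<close> arises once from one of size \<open>n\<close> by appending a last value \<open>c\<close> and
  raising the values that are at least \<open>c\<close>. Appending \<open>c\<close> completes a forbidden pattern exactly if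
  there are \<open>i < j\<close> such that the descent at \<open>j\<close> straddles \<open>\<pi> i\<close> and \<open>c\<close> lands between \<open>\<pi> i\<close> and
  \<open>\<pi> j\<close>; the other \<open>c\<close> are the active sites.
\<close>

definition active :: "nat \<Rightarrow> (nat \<Rightarrow> nat) \<Rightarrow> nat set" where
  "active n \<pi> = {c \<in> {1..n+1}. \<forall>i j. 1 \<le> i \<and> i < j \<and> j + 1 \<le> n \<and> \<pi> (j + 1) < \<pi> i \<longrightarrow>
     \<not> (\<pi> i < c \<and> c \<le> \<pi> j)}"

text \<open>
  The numbers of active sites below and above the last value determine the corresponding numbers for
  all children, so they are the labels of the generating tree and the exponents of \<open>y\<close> and \<open>z\<close>.
\<close>

definition low :: "nat \<Rightarrow> (nat \<Rightarrow> nat) \<Rightarrow> nat" where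
  "low n \<pi> = card {c \<in> active n \<pi>. c \<le> \<pi> n}"

definition high :: "nat \<Rightarrow> (nat \<Rightarrow> nat) \<Rightarrow> nat" where
  "high n \<pi> = card {c \<in> active n \<pi>. \<pi> n < c}"

definition lift :: "nat \<Rightarrow> nat \<Rightarrow> nat" where
  "lift c v = (if c \<le> v then v + 1 else v)"

definition insert_last :: "nat \<Rightarrow> (nat \<Rightarrow> nat) \<Rightarrow> nat \<Rightarrow> nat \<Rightarrow> nat" where
  "insert_last n \<pi> c i = (if i = Suc n then c else if i \<in> {1..n} then lift c (\<pi> i) else i)"

lemma lift_less_iff [simp]: "lift c v < lift c w \<longleftrightarrow> v < w"
  by (auto simp: lift_def)

lemma lift_eq_iff [simp]: "lift c v = lift c w \<longleftrightarrow> v = w"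
  by (auto simp: lift_def)

lemma lift_less_site [simp]: "lift c v < c \<longleftrightarrow> v < c"
  and site_less_lift [simp]: "c < lift c v \<longleftrightarrow> c \<le> v"
  and lift_neq_site [simp]: "lift c v \<noteq> c" "c \<noteq> lift c v"
  by (auto simp: lift_def)

lemma insert_last_new [simp]: "insert_last n \<pi> c (Suc n) = c"
  by (simp add: insert_last_def)

lemma insert_last_old: "1 \<le> i \<Longrightarrow> i \<le> n \<Longrightarrow> insert_last n \<pi> c i = lift c (\<pi> i)"
  by (simp add: insert_last_def)

lemma insert_last_permutes:
  assumes "\<pi> permutes {1..n}" "c \<in> {1..n+1}"
  shows "insert_last n \<pi> c permutes {1..Suc n}"
proof (rule bij_imp_permutes)
  have range: "\<pi> i \<in> {1..n}" if "i \<in> {1..n}" for i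
    using assms(1) that by (simp only: permutes_in_image)
  have inj: "inj_on (insert_last n \<pi> c) {1..Suc n}"
  proof (rule inj_onI)
    fix i j assume *: "i \<in> {1..Suc n}" "j \<in> {1..Suc n}" "insert_last n \<pi> c i = insert_last n \<pi> c j"
    then show "i = j"
      using injD[OF permutes_inj[OF assms(1)], of i j]
      by (cases "i = Suc n"; cases "j = Suc n") (simp_all add: insert_last_old)
  qed
  have "insert_last n \<pi> c ` {1..Suc n} \<subseteq> {1..Suc n}"
  proof (rule image_subsetI)
    fix i assume "i \<in> {1..Suc n}"
    then show "insert_last n \<pi> c i \<in> {1..Suc n}"
      using range[of i] assms(2) by (auto simp: insert_last_def lift_def)
  qed
  then have "insert_last n \<pi> c ` {1..Suc n} = {1..Suc n}"
    using inj by (intro endo_inj_surj) auto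
  then show "bij_betw (insert_last n \<pi> c) {1..Suc n} {1..Suc n}"
    using inj by (simp add: bij_betw_def)
  show "insert_last n \<pi> c i = i" if "i \<notin> {1..Suc n}" for i
    using that by (auto simp: insert_last_def)
qed

lemma insert_last_inj:
  "inj_on (\<lambda>(\<pi>, c). insert_last n \<pi> c) ({\<pi>. \<pi> permutes {1..n}} \<times> {1..n+1})"
proof (rule inj_onI, clarify)
  fix \<pi> \<sigma> c d
  assume *: "\<pi> permutes {1..n}" "\<sigma> permutes {1..n}" "insert_last n \<pi> c = insert_last n \<sigma> d"
  have cd: "c = d" using fun_cong[OF *(3), of "Suc n"] by (simp add: insert_last_def)
  have "\<pi> i = \<sigma> i" for i
  proof (cases "i \<in> {1..n}")
    case True
    then show ?thesis using fun_cong[OF *(3), of i] cd by (auto simp: insert_last_def)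
  next
    case False
    then show ?thesis using *(1,2) by (simp add: permutes_not_in)
  qed
  then show "\<pi> = \<sigma> \<and> c = d" using cd by auto
qed

text \<open>
  Injectivity suffices, since both sides have \<open>(n + 1)!\<close> elements; no inverse map has to be described.
\<close>

lemma insert_last_surj:
  "(\<lambda>(\<pi>, c). insert_last n \<pi> c) ` ({\<pi>. \<pi> permutes {1..n}} \<times> {1..n+1})
     = {\<pi>. \<pi> permutes {1..Suc n}}"
proof (rule card_subset_eq)
  show "finite {\<pi>. \<pi> permutes {1..Suc n}}" by (simp add: finite_permutations)
  show "(\<lambda>(\<pi>, c). insert_last n \<pi> c) ` ({\<pi>. \<pi> permutes {1..n}} \<times> {1..n+1})
     \<subseteq> {\<pi>. \<pi> permutes {1..Suc n}}"
    using insert_last_permutes by auto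
  have "card {\<pi>. \<pi> permutes {1..n}} = fact n" "card {\<pi>. \<pi> permutes {1..Suc n}} = fact (Suc n)"
    by (rule card_permutations; simp)+
  then show "card ((\<lambda>(\<pi>, c). insert_last n \<pi> c) ` ({\<pi>. \<pi> permutes {1..n}} \<times> {1..n+1}))
     = card {\<pi>. \<pi> permutes {1..Suc n}}"
    by (subst card_image[OF insert_last_inj]) (simp add: card_cartesian_product)
qed

lemma semi_baxter_insert_last:
  assumes "\<pi> permutes {1..n}" "c \<in> {1..n+1}"
  shows "semi_baxter (Suc n) (insert_last n \<pi> c) \<longleftrightarrow> semi_baxter n \<pi> \<and> c \<in> active n \<pi>"
proof -
  let ?\<sigma> = "insert_last n \<pi> c"
  let ?P = "\<lambda>\<tau> i j k. \<tau> (j + 1) < \<tau> i \<and> \<tau> i < \<tau> k \<and> \<tau> k < (\<tau> j :: nat)"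
  have old: "?P ?\<sigma> i j k \<longleftrightarrow> ?P \<pi> i j k" if "1 \<le> i" "i < j" "j + 1 < k" "k \<le> n" for i j k
  proof -
    have "insert_last n \<pi> c i = lift c (\<pi> i)" "insert_last n \<pi> c j = lift c (\<pi> j)"
      "insert_last n \<pi> c (j + 1) = lift c (\<pi> (j + 1))" "insert_last n \<pi> c k = lift c (\<pi> k)"
      using that by (simp_all add: insert_last_old)
    then show ?thesis by simp
  qed
  have new: "?P ?\<sigma> i j (Suc n) \<longleftrightarrow> \<pi> (j + 1) < \<pi> i \<and> \<pi> i < c \<and> c \<le> \<pi> j"
    if "1 \<le> i" "i < j" "j + 1 \<le> n" for i j
  proof -
    have "insert_last n \<pi> c i = lift c (\<pi> i)" "insert_last n \<pi> c j = lift c (\<pi> j)"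
      "insert_last n \<pi> c (j + 1) = lift c (\<pi> (j + 1))"
      using that by (simp_all add: insert_last_old)
    then show ?thesis by simp
  qed
  have "(\<exists>i j k. 1 \<le> i \<and> i < j \<and> j + 1 < k \<and> k \<le> Suc n \<and> ?P ?\<sigma> i j k) \<longleftrightarrow>
      (\<exists>i j k. 1 \<le> i \<and> i < j \<and> j + 1 < k \<and> k \<le> n \<and> ?P \<pi> i j k) \<or>
      (\<exists>i j. 1 \<le> i \<and> i < j \<and> j + 1 \<le> n \<and> \<pi> (j + 1) < \<pi> i \<and> \<pi> i < c \<and> c \<le> \<pi> j)"
    (is "?L \<longleftrightarrow> ?R1 \<or> ?R2")
  proof
    assume ?L
    then obtain i j k where *: "1 \<le> i" "i < j" "j + 1 < k" "k \<le> Suc n" "?P ?\<sigma> i j k" by blast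
    show "?R1 \<or> ?R2"
    proof (cases "k = Suc n")
      case True
      then show ?thesis using * new[of i j] by (metis less_Suc_eq_le)
    next
      case False
      then have "k \<le> n" using * by simp
      then show ?thesis using * old[of i j k] by blast
    qed
  next
    assume "?R1 \<or> ?R2"
    then show ?L
    proof
      assume ?R1
      then show ?L using old by (meson le_SucI)
    next
      assume ?R2
      then obtain i j where *: "1 \<le> i" "i < j" "j + 1 \<le> n"
        "\<pi> (j + 1) < \<pi> i \<and> \<pi> i < c \<and> c \<le> \<pi> j" by blast
      have "?P ?\<sigma> i j (Suc n)" using new[OF *(1-3)] *(4) by (rule iffD2)
      moreover have "j + 1 < Suc n" using *(3) by simp
      ultimately show ?L using *(1,2) by blast
    qed
  qed
  moreover have "c \<in> active n \<pi> \<longleftrightarrow> \<not> (\<exists>i j. 1 \<le> i \<and> i < j \<and> j + 1 \<le> n \<and>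
      \<pi> (j + 1) < \<pi> i \<and> \<pi> i < c \<and> c \<le> \<pi> j)"
    using assms(2) unfolding active_def by blast
  ultimately show ?thesis
    using assms(1) insert_last_permutes[OF assms] unfolding semi_baxter_def by argo
qed

lemma semi_baxter_children:
  "{\<sigma>. semi_baxter (Suc n) \<sigma>}
     = (\<lambda>(\<pi>, c). insert_last n \<pi> c) ` (SIGMA \<pi> : {\<pi>. semi_baxter n \<pi>}. active n \<pi>)"
proof (rule set_eqI, rule iffI)
  fix \<sigma> assume \<sigma>: "\<sigma> \<in> {\<sigma>. semi_baxter (Suc n) \<sigma>}"
  then have "\<sigma> \<in> {\<pi>. \<pi> permutes {1..Suc n}}" by (simp add: semi_baxter_def)
  then obtain \<pi> c where \<pi>: "\<pi> permutes {1..n}" "c \<in> {1..n+1}" "\<sigma> = insert_last n \<pi> c"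
    unfolding insert_last_surj[symmetric] by auto
  then show "\<sigma> \<in> (\<lambda>(\<pi>, c). insert_last n \<pi> c) ` (SIGMA \<pi> : {\<pi>. semi_baxter n \<pi>}. active n \<pi>)"
    using \<sigma> semi_baxter_insert_last[OF \<pi>(1,2)] by force
next
  fix \<sigma> assume "\<sigma> \<in> (\<lambda>(\<pi>, c). insert_last n \<pi> c) ` (SIGMA \<pi> : {\<pi>. semi_baxter n \<pi>}. active n \<pi>)"
  then obtain \<pi> c where \<pi>: "semi_baxter n \<pi>" "c \<in> active n \<pi>" "\<sigma> = insert_last n \<pi> c" by auto
  then have "\<pi> permutes {1..n}" "c \<in> {1..n+1}" by (auto simp: semi_baxter_def active_def)
  then show "\<sigma> \<in> {\<sigma>. semi_baxter (Suc n) \<sigma>}" using semi_baxter_insert_last \<pi> by simp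
qed

lemma finite_semi_baxter: "finite {\<pi>. semi_baxter n \<pi>}"
  by (rule finite_subset[OF _ finite_permutations[of "{1..n}"]]) (auto simp: semi_baxter_def)

lemma finite_active [simp]: "finite (active n \<pi>)"
  by (simp add: active_def)

text \<open>
  A site \<open>d\<close> of the child sits over the site \<open>e\<close> of the parent, where \<open>c\<close> and \<open>c + 1\<close> both sit over \<open>c\<close>.
  Old pairs \<open>(i, j)\<close> block \<open>d\<close> if and only if they block \<open>e\<close>. The only new pairs use the descent into the
  appended value; since every value occurs, they block precisely the sites strictly above that value
  and not above the old last value.
\<close>

lemma active_insert_last:
  assumes \<pi>: "\<pi> permutes {1..n}" and n: "1 \<le> n" and c: "c \<in> {1..n+1}" and d: "1 \<le> d" "d \<le> n + 2"
  defines "e \<equiv> if d \<le> c then d else d - 1"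
  shows "d \<in> active (Suc n) (insert_last n \<pi> c) \<longleftrightarrow> e \<in> active n \<pi> \<and> \<not> (c < e \<and> e \<le> \<pi> n)"
proof -
  let ?\<sigma> = "insert_last n \<pi> c"
  let ?Q = "\<lambda>\<tau> i j d. \<tau> (j + 1) < \<tau> i \<and> \<tau> i < d \<and> d \<le> (\<tau> j :: nat)"
  have less: "lift c v < d \<longleftrightarrow> v < e" for v
    unfolding lift_def e_def by (cases "c \<le> v"; cases "d \<le> c"; simp; linarith)
  have le: "d \<le> lift c v \<longleftrightarrow> e \<le> v" for v using less[of v] by (simp flip: not_less)
  have e: "1 \<le> e" "e \<le> n + 1" using d c by (auto simp: e_def)
  have old: "?Q ?\<sigma> i j d \<longleftrightarrow> ?Q \<pi> i j e" if "1 \<le> i" "i < j" "j + 1 \<le> n" for i j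
  proof -
    have "insert_last n \<pi> c i = lift c (\<pi> i)" "insert_last n \<pi> c j = lift c (\<pi> j)"
      "insert_last n \<pi> c (j + 1) = lift c (\<pi> (j + 1))"
      using that by (simp_all add: insert_last_old)
    then show ?thesis by (simp add: less le)
  qed
  have last: "(\<exists>i. 1 \<le> i \<and> i < n \<and> ?Q ?\<sigma> i n d) \<longleftrightarrow> c < e \<and> e \<le> \<pi> n"
  proof
    assume "\<exists>i. 1 \<le> i \<and> i < n \<and> ?Q ?\<sigma> i n d"
    then show "c < e \<and> e \<le> \<pi> n" by (auto simp: insert_last_def less le)
  next
    assume *: "c < e \<and> e \<le> \<pi> n"
    \<comment> \<open>the value \<open>c\<close> of the parent becomes \<open>c + 1\<close> and plays the middle role of the pattern\<close>
    have "\<pi> n \<in> {1..n}" using n permutes_in_image[OF \<pi>, of n] by simp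
    then have "c \<in> {1..n}" using * c by auto
    then have "inv \<pi> c \<in> {1..n}" using permutes_in_image[OF permutes_inv[OF \<pi>]] by blast
    moreover have "\<pi> (inv \<pi> c) = c" using permutes_inverses(1)[OF \<pi>] by simp
    moreover have "inv \<pi> c \<noteq> n" using * calculation(2) by auto
    ultimately have "1 \<le> inv \<pi> c \<and> inv \<pi> c < n \<and> ?Q ?\<sigma> (inv \<pi> c) n d"
      using * by (simp add: insert_last_def less le n)
    then show "\<exists>i. 1 \<le> i \<and> i < n \<and> ?Q ?\<sigma> i n d" by blast
  qed
  have "(\<exists>i j. 1 \<le> i \<and> i < j \<and> j + 1 \<le> Suc n \<and> ?Q ?\<sigma> i j d) \<longleftrightarrow>
      (\<exists>i j. 1 \<le> i \<and> i < j \<and> j + 1 \<le> n \<and> ?Q ?\<sigma> i j d) \<or> (\<exists>i. 1 \<le> i \<and> i < n \<and> ?Q ?\<sigma> i n d)"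
    (is "?L \<longleftrightarrow> ?R")
  proof
    assume ?L
    then obtain i j where *: "1 \<le> i" "i < j" "j + 1 \<le> Suc n" "?Q ?\<sigma> i j d" by blast
    show ?R
    proof (cases "j = n")
      case True
      then show ?thesis using * by blast
    next
      case False
      then have "j + 1 \<le> n" using * by simp
      then show ?thesis using * by blast
    qed
  next
    assume ?R
    then show ?L
    proof
      assume "\<exists>i j. 1 \<le> i \<and> i < j \<and> j + 1 \<le> n \<and> ?Q ?\<sigma> i j d"
      then show ?L by (meson le_SucI)
    next
      assume "\<exists>i. 1 \<le> i \<and> i < n \<and> ?Q ?\<sigma> i n d"
      moreover have "n + 1 \<le> Suc n" by simp
      ultimately show ?L by blast
    qed
  qed
  also have "(\<exists>i j. 1 \<le> i \<and> i < j \<and> j + 1 \<le> n \<and> ?Q ?\<sigma> i j d) \<longleftrightarrow>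
      (\<exists>i j. 1 \<le> i \<and> i < j \<and> j + 1 \<le> n \<and> ?Q \<pi> i j e)"
    using old by blast
  finally have key: "?L \<longleftrightarrow>
      (\<exists>i j. 1 \<le> i \<and> i < j \<and> j + 1 \<le> n \<and> ?Q \<pi> i j e) \<or> (c < e \<and> e \<le> \<pi> n)"
    unfolding last .
  have "d \<in> active (Suc n) ?\<sigma> \<longleftrightarrow> \<not> ?L" using d by (auto simp: active_def)
  moreover have "e \<in> active n \<pi> \<longleftrightarrow> \<not> (\<exists>i j. 1 \<le> i \<and> i < j \<and> j + 1 \<le> n \<and> ?Q \<pi> i j e)"
    using e by (auto simp: active_def)
  ultimately show ?thesis using key by blast
qed

lemma low_insert_last:
  assumes \<pi>: "\<pi> permutes {1..n}" and n: "1 \<le> n" and c: "c \<in> active n \<pi>"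
  shows "low (Suc n) (insert_last n \<pi> c) = card {e \<in> active n \<pi>. e \<le> c}"
proof -
  have c': "c \<in> {1..n+1}" using c by (simp add: active_def)
  have "d \<in> active (Suc n) (insert_last n \<pi> c) \<longleftrightarrow> d \<in> active n \<pi>" if "d \<le> c" for d
  proof (cases "1 \<le> d")
    case True
    then show ?thesis using active_insert_last[OF \<pi> n c' True] that c' by simp
  qed (simp add: active_def)
  then show ?thesis unfolding low_def
    by (intro arg_cong[where f = card]) (auto simp: insert_last_def)
qed

lemma high_insert_last:
  assumes \<pi>: "\<pi> permutes {1..n}" and n: "1 \<le> n" and c: "c \<in> active n \<pi>"
  shows "high (Suc n) (insert_last n \<pi> c)
    = card {e \<in> active n \<pi>. c \<le> e \<and> \<not> (c < e \<and> e \<le> \<pi> n)}"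
proof -
  have c': "c \<in> {1..n+1}" using c by (simp add: active_def)
  have *: "Suc e \<in> active (Suc n) (insert_last n \<pi> c) \<longleftrightarrow>
      e \<in> active n \<pi> \<and> \<not> (c < e \<and> e \<le> \<pi> n)" if "c \<le> e" for e
  proof (cases "e \<le> n + 1")
    case True
    then show ?thesis using active_insert_last[OF \<pi> n c', of "Suc e"] that c' by simp
  qed (simp add: active_def)
  have "{d \<in> active (Suc n) (insert_last n \<pi> c). insert_last n \<pi> c (Suc n) < d}
      = Suc ` {e \<in> active n \<pi>. c \<le> e \<and> \<not> (c < e \<and> e \<le> \<pi> n)}"
  proof (rule set_eqI)
    fix d show "d \<in> {d \<in> active (Suc n) (insert_last n \<pi> c). insert_last n \<pi> c (Suc n) < d} \<longleftrightarrow>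
        d \<in> Suc ` {e \<in> active n \<pi>. c \<le> e \<and> \<not> (c < e \<and> e \<le> \<pi> n)}"
      by (cases d) (use * in \<open>auto simp: insert_last_def\<close>)
  qed
  then show ?thesis unfolding high_def by (simp add: card_image)
qed

lemma sum_rank:
  fixes X :: "nat set"
  assumes "finite X"
  shows "(\<Sum>c\<in>X. f (card {e \<in> X. e \<le> c})) = (\<Sum>i=1..card X. f i)"
  using assms
proof (induction X rule: finite_linorder_max_induct)
  case (insert b X)
  have "{e \<in> insert b X. e \<le> b} = insert b X" using insert by force
  moreover have "{e \<in> insert b X. e \<le> c} = {e \<in> X. e \<le> c}" if "c \<in> X" for c
    using insert that by force
  moreover have "b \<notin> X" using insert by auto
  ultimately show ?case using insert by (simp add: add.commute)
qed simp

text \<open>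
  The succession rule \<open>(h, k) \<mapsto> (1, k + 1), \<dots>, (h, k + 1), (h + k, 1), \<dots>, (h + 1, k)\<close>: a descent to the
  \<open>i\<close>-th lowest site kills the sites that it jumps over, an ascent only splits a site.
\<close>

lemma sum_children:
  assumes \<pi>: "\<pi> permutes {1..n}" and n: "1 \<le> n"
  shows "(\<Sum>c\<in>active n \<pi>. f (low (Suc n) (insert_last n \<pi> c)) (high (Suc n) (insert_last n \<pi> c)))
    = (\<Sum>i=1..low n \<pi>. f i (high n \<pi> + 1)) + (\<Sum>i=1..high n \<pi>. f (low n \<pi> + i) (high n \<pi> + 1 - i))"
proof -
  define L H where "L = {c \<in> active n \<pi>. c \<le> \<pi> n}" and "H = {c \<in> active n \<pi>. \<pi> n < c}"
  have fin: "finite L" "finite H" and disj: "L \<inter> H = {}" and un: "active n \<pi> = L \<union> H"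
    by (auto simp: L_def H_def)
  have card: "low n \<pi> = card L" "high n \<pi> = card H" by (simp_all add: L_def H_def low_def high_def)
  have L: "low (Suc n) (insert_last n \<pi> c) = card {e \<in> L. e \<le> c}"
    "high (Suc n) (insert_last n \<pi> c) = card H + 1" if "c \<in> L" for c
  proof -
    have c: "c \<in> active n \<pi>" "c \<le> \<pi> n" using that by (auto simp: L_def)
    have "{e \<in> active n \<pi>. e \<le> c} = {e \<in> L. e \<le> c}" using c by (auto simp: L_def)
    then show "low (Suc n) (insert_last n \<pi> c) = card {e \<in> L. e \<le> c}"
      using low_insert_last[OF \<pi> n c(1)] by simp
    have "{e \<in> active n \<pi>. c \<le> e \<and> \<not> (c < e \<and> e \<le> \<pi> n)} = insert c H"
      using c by (auto simp: H_def)
    moreover have "c \<notin> H" using c by (auto simp: H_def)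
    ultimately show "high (Suc n) (insert_last n \<pi> c) = card H + 1"
      using high_insert_last[OF \<pi> n c(1)] fin by simp
  qed
  have H: "low (Suc n) (insert_last n \<pi> c) = card L + card {e \<in> H. e \<le> c}"
    "high (Suc n) (insert_last n \<pi> c) = card H + 1 - card {e \<in> H. e \<le> c}" if "c \<in> H" for c
  proof -
    have c: "c \<in> active n \<pi>" "\<pi> n < c" using that by (auto simp: H_def)
    have "{e \<in> active n \<pi>. e \<le> c} = L \<union> {e \<in> H. e \<le> c}" using c by (auto simp: L_def H_def)
    moreover have "L \<inter> {e \<in> H. e \<le> c} = {}" using disj by auto
    ultimately show "low (Suc n) (insert_last n \<pi> c) = card L + card {e \<in> H. e \<le> c}"
      using low_insert_last[OF \<pi> n c(1)] fin by (simp add: card_Un_disjoint)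
    have "{e \<in> active n \<pi>. c \<le> e \<and> \<not> (c < e \<and> e \<le> \<pi> n)} = {e \<in> H. c \<le> e}"
      using c by (auto simp: H_def)
    moreover have "card {e \<in> H. c \<le> e} + card {e \<in> H. e \<le> c} = card H + 1"
    proof -
      have "card {e \<in> H. c \<le> e} + card {e \<in> H. e \<le> c}
          = card ({e \<in> H. c \<le> e} \<union> {e \<in> H. e \<le> c}) + card ({e \<in> H. c \<le> e} \<inter> {e \<in> H. e \<le> c})"
        using fin by (intro card_Un_Int) auto
      also have "{e \<in> H. c \<le> e} \<union> {e \<in> H. e \<le> c} = H" by auto
      also have "{e \<in> H. c \<le> e} \<inter> {e \<in> H. e \<le> c} = {c}" using that by auto
      finally show ?thesis by simp
    qed
    ultimately show "high (Suc n) (insert_last n \<pi> c) = card H + 1 - card {e \<in> H. e \<le> c}"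
      using high_insert_last[OF \<pi> n c(1)] by simp
  qed
  have "(\<Sum>c\<in>active n \<pi>. f (low (Suc n) (insert_last n \<pi> c)) (high (Suc n) (insert_last n \<pi> c)))
    = (\<Sum>c\<in>L. f (card {e \<in> L. e \<le> c}) (card H + 1)) +
      (\<Sum>c\<in>H. f (card L + card {e \<in> H. e \<le> c}) (card H + 1 - card {e \<in> H. e \<le> c}))"
    unfolding un using fin disj by (simp add: sum.union_disjoint L H)
  also have "\<dots> = (\<Sum>i=1..card L. f i (card H + 1)) + (\<Sum>i=1..card H. f (card L + i) (card H + 1 - i))"
    using sum_rank[OF fin(1), of "\<lambda>i. f i (card H + 1)"]
      sum_rank[OF fin(2), of "\<lambda>i. f (card L + i) (card H + 1 - i)"] by simp
  finally show ?thesis unfolding card .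
qed

text \<open>
  This is the coefficient of \<open>x^n\<close> in \<open>S(u, v)\<close>. It makes sense in every commutative ring, so that
  substitutions, including those of power series for \<open>y\<close> and \<open>z\<close>, need no polynomials.
\<close>

definition sb_weight :: "nat \<Rightarrow> 'b::comm_ring_1 \<Rightarrow> 'b \<Rightarrow> 'b" where
  "sb_weight n u v = (if n = 0 then 0 else \<Sum>\<pi> | semi_baxter n \<pi>. u ^ low n \<pi> * v ^ high n \<pi>)"

lemma sb_weight_0 [simp]: "sb_weight 0 u v = 0"
  by (simp add: sb_weight_def)

lemma sb_weight_1 [simp]: "sb_weight (Suc 0) u v = u * v"
proof -
  have "{\<pi>. semi_baxter (Suc 0) \<pi>} = {id}"
    by (auto simp: semi_baxter_def)
  moreover have "active (Suc 0) id = {1, 2}" by (auto simp: active_def)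
  moreover have "{c. (c = Suc 0 \<or> c = 2) \<and> c \<le> Suc 0} = {1}"
    "{c. (c = Suc 0 \<or> c = 2) \<and> Suc 0 < c} = {2}" by auto
  ultimately show ?thesis by (simp add: sb_weight_def low_def high_def)
qed

lemma sb_weight_Suc:
  assumes "1 \<le> n"
  shows "sb_weight (Suc n) u v = (\<Sum>\<pi> | semi_baxter n \<pi>.
    (\<Sum>i=1..low n \<pi>. u ^ i * v ^ (high n \<pi> + 1)) +
    (\<Sum>i=1..high n \<pi>. u ^ (low n \<pi> + i) * v ^ (high n \<pi> + 1 - i)))"
proof -
  let ?w = "\<lambda>\<pi>. u ^ low (Suc n) \<pi> * v ^ high (Suc n) \<pi>"
  have "inj_on (\<lambda>(\<pi>, c). insert_last n \<pi> c) (SIGMA \<pi> : {\<pi>. semi_baxter n \<pi>}. active n \<pi>)"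
    by (rule inj_on_subset[OF insert_last_inj]) (auto simp: semi_baxter_def active_def)
  then have "sb_weight (Suc n) u v
      = (\<Sum>(\<pi>, c) \<in> (SIGMA \<pi> : {\<pi>. semi_baxter n \<pi>}. active n \<pi>). ?w (insert_last n \<pi> c))"
    unfolding sb_weight_def semi_baxter_children
    by (simp add: sum.reindex case_prod_unfold)
  also have "\<dots> = (\<Sum>\<pi> | semi_baxter n \<pi>. \<Sum>c\<in>active n \<pi>. ?w (insert_last n \<pi> c))"
    by (rule sum.Sigma[symmetric]) (auto simp: finite_semi_baxter)
  also have "\<dots> = (\<Sum>\<pi> | semi_baxter n \<pi>.
    (\<Sum>i=1..low n \<pi>. u ^ i * v ^ (high n \<pi> + 1)) +
    (\<Sum>i=1..high n \<pi>. u ^ (low n \<pi> + i) * v ^ (high n \<pi> + 1 - i)))"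
    using assms
    by (intro sum.cong refl sum_children[where f = "\<lambda>h k. u ^ h * v ^ k"])
      (auto simp: semi_baxter_def)
  finally show ?thesis .
qed

lemma geometric_low:
  fixes u :: "'b::comm_ring_1"
  shows "(1 - u) * (\<Sum>i=1..h. u ^ i) = u * (1 - u ^ h)"
proof (induction h)
  case (Suc h)
  have "(1 - u) * (\<Sum>i=1..Suc h. u ^ i) = (1 - u) * (\<Sum>i=1..h. u ^ i) + (1 - u) * u ^ Suc h"
    by (simp add: distrib_left)
  also have "\<dots> = u * (1 - u ^ Suc h)" unfolding Suc.IH by (simp add: algebra_simps)
  finally show ?case .
qed simp

lemma geometric_high:
  fixes u v :: "'b::comm_ring_1"
  shows "(v - u) * (\<Sum>i=1..k. u ^ i * v ^ (k + 1 - i)) = u * v * (v ^ k - u ^ k)"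
proof (induction k)
  case (Suc k)
  have "(\<Sum>i=1..k. u ^ i * v ^ (Suc k + 1 - i)) = v * (\<Sum>i=1..k. u ^ i * v ^ (k + 1 - i))"
    unfolding sum_distrib_left
    by (rule sum.cong) (auto simp: Suc_diff_le)
  then have "(v - u) * (\<Sum>i=1..Suc k. u ^ i * v ^ (Suc k + 1 - i))
      = v * ((v - u) * (\<Sum>i=1..k. u ^ i * v ^ (k + 1 - i))) + (v - u) * (u ^ Suc k * v)"
    by (simp add: algebra_simps)
  then show ?case unfolding Suc.IH by (simp add: algebra_simps)
qed simp

text \<open>
  Multiplication by \<open>(1 - u) * (v - u)\<close> turns the two geometric sums of the succession rule into the
  divided differences of the functional equation.
\<close>

lemma sb_weight_functional:
  fixes u v :: "'b::comm_ring_1"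
  shows "(1 - u) * (v - u) * sb_weight (Suc n) u v
    = (if n = 0 then (1 - u) * (v - u) * (u * v) else 0)
      + u * v * (v - u) * (sb_weight n 1 v - sb_weight n u v)
      + u * v * (1 - u) * (sb_weight n u v - sb_weight n u u)"
proof (cases "n = 0")
  case False
  define h k where "h = low n" and "k = high n"
  have "(1 - u) * (v - u) * ((\<Sum>i=1..h \<pi>. u ^ i * v ^ (k \<pi> + 1))
      + (\<Sum>i=1..k \<pi>. u ^ (h \<pi> + i) * v ^ (k \<pi> + 1 - i)))
    = u * v * (v - u) * (1 ^ h \<pi> * v ^ k \<pi> - u ^ h \<pi> * v ^ k \<pi>)
      + u * v * (1 - u) * (u ^ h \<pi> * v ^ k \<pi> - u ^ h \<pi> * u ^ k \<pi>)" for \<pi>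
  proof -
    have "(\<Sum>i=1..h \<pi>. u ^ i * v ^ (k \<pi> + 1)) = v * v ^ k \<pi> * (\<Sum>i=1..h \<pi>. u ^ i)"
      "(\<Sum>i=1..k \<pi>. u ^ (h \<pi> + i) * v ^ (k \<pi> + 1 - i))
        = u ^ h \<pi> * (\<Sum>i=1..k \<pi>. u ^ i * v ^ (k \<pi> + 1 - i))"
      by (simp_all add: power_add sum_distrib_left mult_ac)
    then have "(1 - u) * (v - u) * ((\<Sum>i=1..h \<pi>. u ^ i * v ^ (k \<pi> + 1))
      + (\<Sum>i=1..k \<pi>. u ^ (h \<pi> + i) * v ^ (k \<pi> + 1 - i)))
      = v * v ^ k \<pi> * (v - u) * ((1 - u) * (\<Sum>i=1..h \<pi>. u ^ i))
      + u ^ h \<pi> * (1 - u) * ((v - u) * (\<Sum>i=1..k \<pi>. u ^ i * v ^ (k \<pi> + 1 - i)))"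
      by (simp only:) (simp add: algebra_simps)
    then show ?thesis unfolding geometric_low geometric_high by (simp add: algebra_simps)
  qed
  note * = this
  have "sb_weight (Suc n) u v = (\<Sum>\<pi> | semi_baxter n \<pi>. (\<Sum>i=1..h \<pi>. u ^ i * v ^ (k \<pi> + 1))
      + (\<Sum>i=1..k \<pi>. u ^ (h \<pi> + i) * v ^ (k \<pi> + 1 - i)))"
    using False unfolding h_def k_def by (intro sb_weight_Suc) simp
  then have "(1 - u) * (v - u) * sb_weight (Suc n) u v = (\<Sum>\<pi> | semi_baxter n \<pi>.
      u * v * (v - u) * (1 ^ h \<pi> * v ^ k \<pi> - u ^ h \<pi> * v ^ k \<pi>)
      + u * v * (1 - u) * (u ^ h \<pi> * v ^ k \<pi> - u ^ h \<pi> * u ^ k \<pi>))"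
    by (simp only: sum_distrib_left *)
  also have "\<dots> = u * v * (v - u) * (sb_weight n 1 v - sb_weight n u v)
      + u * v * (1 - u) * (sb_weight n u v - sb_weight n u u)"
    using False unfolding sb_weight_def h_def k_def
    by (simp only: if_False sum.distrib flip: sum_distrib_left sum_subtractf)
  finally show ?thesis using False by simp
qed simp

section \<open>The solution of the functional equation\<close>

definition eval2 :: "(rat \<Rightarrow> 'b::comm_ring_1) \<Rightarrow> rat poly poly \<Rightarrow> 'b \<Rightarrow> 'b \<Rightarrow> 'b" where
  "eval2 \<iota> p u v = poly (map_poly (\<lambda>q. poly (map_poly \<iota> q) v) p) u"

lemma fps_nth_subst_yz [simp]: "fps_nth (subst_yz \<iota> S u v) n = eval2 \<iota> (fps_nth S n) u v"
  by (simp add: subst_yz_def eval2_def)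

lemma map_poly_add:
  assumes "\<And>x y. f (x + y) = f x + f y" "f 0 = 0"
  shows "map_poly f (p + q) = map_poly f p + map_poly f q"
  by (rule poly_eqI) (simp add: coeff_map_poly assms)

lemma eval2_add:
  assumes "\<And>x y. \<iota> (x + y) = \<iota> x + \<iota> y" "\<iota> 0 = 0"
  shows "eval2 \<iota> (p + q) u v = eval2 \<iota> p u v + eval2 \<iota> q u v"
  unfolding eval2_def
  by (subst map_poly_add) (simp_all add: map_poly_add assms)

lemma eval2_0 [simp]: "eval2 \<iota> 0 u v = 0"
  by (simp add: eval2_def)

lemma eval2_sum:
  assumes "\<And>x y. \<iota> (x + y) = \<iota> x + \<iota> y" "\<iota> 0 = 0"
  shows "eval2 \<iota> (sum f X) u v = (\<Sum>x\<in>X. eval2 \<iota> (f x) u v)"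
  by (induction X rule: infinite_finite_induct) (simp_all add: eval2_add[OF assms])

abbreviation (input) y_var :: "rat poly poly" where "y_var \<equiv> [:0, 1:]"
abbreviation (input) z_var :: "rat poly poly" where "z_var \<equiv> [:[:0, 1:]:]"

lemma yz_power: "y_var ^ h * z_var ^ k = monom (monom 1 k) h"
proof -
  have "z_var ^ k = [:[:0, 1:] ^ k:]" by (induction k) simp_all
  moreover have "[:0, 1:] ^ k = (monom 1 k :: rat poly)"
    using monom_altdef[of "1 :: rat" k] by simp
  moreover have "y_var ^ h = monom 1 h"
    using monom_altdef[of "1 :: rat poly" h] by simp
  ultimately show ?thesis by (simp add: mult.commute[of "monom 1 h"] smult_monom)
qed

lemma eval2_monom:
  assumes "\<iota> 0 = 0" "\<iota> 1 = 1"
  shows "eval2 \<iota> (y_var ^ h * z_var ^ k) u v = u ^ h * v ^ k"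
  unfolding yz_power eval2_def using assms
  by (simp add: map_poly_monom poly_monom mult.commute)

lemma eval2_sb_weight:
  assumes "\<And>x y. \<iota> (x + y) = \<iota> x + \<iota> y" "\<iota> 0 = 0" "\<iota> 1 = 1"
  shows "eval2 \<iota> (sb_weight n y_var z_var) u v = sb_weight n u v"
  unfolding sb_weight_def by (simp only: eval2_sum eval2_monom assms eval2_0 if_distrib[of "\<lambda>p. eval2 \<iota> p u v"] cong: if_cong)

abbreviation of_poly2 :: "rat poly poly \<Rightarrow> rat poly poly fract" where
  "of_poly2 p \<equiv> Fraction_Field.Fract p 1"

lemma eval2_Fract:
  "eval2 (\<lambda>c. of_poly2 [:[:c:]:]) p (of_poly2 y_var) (of_poly2 z_var) = of_poly2 p"
proof -
  have inner: "poly (map_poly (\<lambda>c. of_poly2 [:[:c:]:]) q) (of_poly2 z_var) = of_poly2 [:q:]" for q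
  proof (induction q)
    case (pCons c q)
    then show ?case by (simp add: map_poly_pCons Zero_fract_def)
  qed (simp add: Zero_fract_def)
  show ?thesis unfolding eval2_def inner
  proof (induction p)
    case (pCons c p)
    then show ?case by (simp add: map_poly_pCons Zero_fract_def)
  qed (simp add: Zero_fract_def)
qed

lemma of_poly2_const_hom:
  "of_poly2 [:[:x + y:]:] = of_poly2 [:[:x:]:] + of_poly2 [:[:y:]:]" "of_poly2 [:[:0:]:] = 0" "of_poly2 [:[:1:]:] = 1"
  by (simp_all add: Zero_fract_def One_fract_def flip: one_pCons)

definition sb_series :: "rat poly poly fps" where
  "sb_series = Abs_fps (\<lambda>n. sb_weight n y_var z_var)"

text \<open>
  Comparing coefficients of \<open>x^n\<close> makes the equation a recursion, because both terms with \<open>S\<close> on the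
  right carry a factor \<open>x\<close>. Existence and uniqueness of the solution follow from it.
\<close>

lemma semi_baxter_equation_iff:
  "semi_baxter_equation S \<longleftrightarrow> fps_nth S 0 = 0 \<and>
    (\<forall>n. let y = of_poly2 y_var; z = of_poly2 z_var; s = eval2 (\<lambda>c. of_poly2 [:[:c:]:]) (fps_nth S n) in
      of_poly2 (fps_nth S (Suc n)) = (if n = 0 then y * z else 0)
         + y * z / (1 - y) * (s 1 z - s y z) + y * z / (z - y) * (s y z - s y y))"
proof -
  have nat: "(\<forall>n. P n) \<longleftrightarrow> P 0 \<and> (\<forall>n. P (Suc n))" for P :: "nat \<Rightarrow> bool"
    by (metis not0_implies_Suc)
  have "of_poly2 p = 0 \<longleftrightarrow> p = 0" for p by (simp add: Zero_fract_def eq_fract)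
  then show ?thesis
    unfolding semi_baxter_equation_def Let_def fps_eq_iff
    by (subst nat) (simp add: eval2_Fract mult.assoc fps_mult_left_const_nth fps_X_mult_right_nth)
qed

lemma semi_baxter_equation_sb_series: "semi_baxter_equation sb_series"
  unfolding semi_baxter_equation_iff
proof (intro conjI allI)
  show "fps_nth sb_series 0 = 0" by (simp add: sb_series_def)
  fix n
  define y z where "y = of_poly2 y_var" and "z = of_poly2 z_var"
  have neq: "1 - y \<noteq> 0" "z - y \<noteq> 0"
    by (auto simp: y_def z_def One_fract_def Zero_fract_def eq_fract one_pCons)
  have "of_poly2 (sb_weight (Suc n) y_var z_var) = sb_weight (Suc n) y z"
    using eval2_Fract[of "sb_weight (Suc n) y_var z_var"]
      eval2_sb_weight[of "\<lambda>c. of_poly2 [:[:c:]:]", OF of_poly2_const_hom, of "Suc n" y z]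
    unfolding y_def z_def by (rule trans[OF sym])
  moreover have "sb_weight (Suc n) y z = (if n = 0 then y * z else 0)
    + y * z / (1 - y) * (sb_weight n 1 z - sb_weight n y z)
    + y * z / (z - y) * (sb_weight n y z - sb_weight n y y)"
    using sb_weight_functional[of y z n] neq
    by (cases "n = 0") (simp_all add: divide_simps mult_ac)
  ultimately show "let y = of_poly2 y_var; z = of_poly2 z_var; s = eval2 (\<lambda>c. of_poly2 [:[:c:]:]) (fps_nth sb_series n) in
      of_poly2 (fps_nth sb_series (Suc n)) = (if n = 0 then y * z else 0)
         + y * z / (1 - y) * (s 1 z - s y z) + y * z / (z - y) * (s y z - s y y)"
    unfolding Let_def sb_series_def fps_nth_Abs_fps y_def[symmetric] z_def[symmetric]
      eval2_sb_weight[of "\<lambda>c. of_poly2 [:[:c:]:]", OF of_poly2_const_hom]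
    by simp
qed

lemma semi_baxter_equation_unique:
  assumes "semi_baxter_equation S" "semi_baxter_equation T"
  shows "S = T"
proof (rule fps_ext)
  fix n
  show "fps_nth S n = fps_nth T n"
  proof (induction n)
    case 0
    then show ?case using assms by (simp add: semi_baxter_equation_iff)
  next
    case (Suc n)
    have "of_poly2 (fps_nth S (Suc n)) = of_poly2 (fps_nth T (Suc n))"
      using assms Suc by (simp add: semi_baxter_equation_iff Let_def)
    then show ?case by (simp add: eq_fract)
  qed
qed

lemma S_one_one_sb_series: "S_one_one sb_series = SB_gf"
  by (rule fps_ext)
    (simp add: S_one_one_def SB_gf_def sb_series_def eval2_sb_weight, simp add: SB_def sb_weight_def)

text \<open>
  The weights are polynomial expressions with integer coefficients, hence compatible with every ring
  homomorphism.
\<close>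

lemma sb_weight_hom:
  assumes "\<And>x y. f (x + y) = f x + f y" "\<And>x y. f (x * y) = f x * f y" "f 0 = 0" "f 1 = 1"
  shows "f (sb_weight n u v) = sb_weight n (f u) (f v)"
proof -
  have "f (x ^ k) = f x ^ k" for x k by (induction k) (simp_all add: assms)
  moreover have "f (sum g X) = (\<Sum>x\<in>X. f (g x))" for g :: "(nat \<Rightarrow> nat) \<Rightarrow> 'a" and X
    by (induction X rule: infinite_finite_induct) (simp_all add: assms)
  ultimately show ?thesis by (simp add: sb_weight_def assms)
qed

lemma S_one_plus_a_sb_series:
  "fps_nth (S_one_plus_a sb_series) n = sb_weight n (1 + fps_X) (1 + fps_X)"
proof -
  have "fps_nth (S_one_plus_a sb_series) n = fps_of_poly (sb_weight n [:1, 1:] [:1, 1:])"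
    by (simp add: S_one_plus_a_def sb_series_def eval2_sb_weight)
  also have "\<dots> = sb_weight n (1 + fps_X) (1 + fps_X)"
    by (subst sb_weight_hom[where f = fps_of_poly]) (simp_all add: fps_of_poly_add fps_of_poly_mult fps_of_poly_pCons)
  finally show ?thesis .
qed

section \<open>The kernel method\<close>

text \<open>
  The sum of \<open>x^n * f n\<close> over all \<open>n\<close>, where \<open>f n\<close> may involve \<open>x\<close> itself: only the terms with \<open>n\<close> up to
  \<open>N\<close> contribute to the coefficient of \<open>x^N\<close>. It expresses the substitution of series in \<open>x\<close> for \<open>y\<close>
  and \<open>z\<close>.
\<close>

definition collapse :: "(nat \<Rightarrow> 'c::comm_ring_1 fps) \<Rightarrow> 'c fps" where
  "collapse f = Abs_fps (\<lambda>N. fps_nth (\<Sum>n\<le>N. fps_X ^ n * f n) N)"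

lemma collapse_nth:
  assumes "K \<le> N"
  shows "fps_nth (\<Sum>n\<le>N. fps_X ^ n * f n) K = fps_nth (collapse f) K"
  using assms
proof (induction N rule: dec_induct)
  case base
  then show ?case by (simp add: collapse_def)
next
  case (step N)
  have "fps_nth (fps_X ^ Suc N * f (Suc N)) K = 0"
    using step.hyps by (subst fps_X_power_mult_nth) simp
  then show ?case using step by simp
qed

lemma collapse_mult: "collapse (\<lambda>n. u * f n) = u * collapse f"
proof (rule fps_ext)
  fix N
  have "fps_nth (collapse (\<lambda>n. u * f n)) N = fps_nth (u * (\<Sum>n\<le>N. fps_X ^ n * f n)) N"
    by (simp add: collapse_def sum_distrib_left mult.left_commute)
  also have "\<dots> = fps_nth (u * collapse f) N"
    unfolding fps_mult_nth by (intro sum.cong refl arg_cong2[where f = "(*)"] collapse_nth) auto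
  finally show "fps_nth (collapse (\<lambda>n. u * f n)) N = fps_nth (u * collapse f) N" .
qed

lemma collapse_add: "collapse (\<lambda>n. f n + g n) = collapse f + collapse g"
  by (rule fps_ext) (simp add: collapse_def distrib_left sum.distrib fps_sum_nth)

lemma collapse_diff: "collapse (\<lambda>n. f n - g n) = collapse f - collapse g"
  by (rule fps_ext) (simp add: collapse_def right_diff_distrib sum_subtractf fps_sum_nth)

lemma collapse_Suc: "collapse f = f 0 + fps_X * collapse (\<lambda>n. f (Suc n))"
proof (rule fps_ext)
  fix N
  show "fps_nth (collapse f) N = fps_nth (f 0 + fps_X * collapse (\<lambda>n. f (Suc n))) N"
  proof (cases N)
    case 0
    then show ?thesis by (simp add: collapse_def)
  next
    case (Suc M)
    have "(\<Sum>n\<le>N. fps_X ^ n * f n) = f 0 + fps_X * (\<Sum>n\<le>M. fps_X ^ n * f (Suc n))"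
      unfolding Suc sum.atMost_Suc_shift by (simp add: sum_distrib_left mult.assoc)
    then show ?thesis by (simp add: collapse_def Suc)
  qed
qed

lemma collapse_const: "collapse (\<lambda>n. fps_const (f n)) = Abs_fps f"
proof (rule fps_ext)
  fix N
  show "fps_nth (collapse (\<lambda>n. fps_const (f n))) N = fps_nth (Abs_fps f) N"
  proof -
    have "fps_nth (fps_X ^ n * fps_const (f n)) N = (if n = N then f n else 0)" for n
      by auto
    then show ?thesis by (simp add: collapse_def fps_sum_nth)
  qed
qed

definition sb_at :: "'c::comm_ring_1 fps \<Rightarrow> 'c fps \<Rightarrow> 'c fps" where
  "sb_at u v = collapse (\<lambda>n. sb_weight n u v)"

lemma sb_at_functional:
  "(1 - u) * (v - u) * sb_at u v
    = fps_X * (u * v) * ((1 - u) * (v - u) + (v - u) * (sb_at 1 v - sb_at u v)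
        + (1 - u) * (sb_at u v - sb_at u u))"
proof -
  have at_zero: "collapse (\<lambda>n. if n = 0 then c else 0) = c" for c :: "'b::comm_ring_1 fps"
    by (subst collapse_Suc) (simp add: fps_eq_iff collapse_def)
  have "(1 - u) * (v - u) * sb_at u v
      = fps_X * collapse (\<lambda>n. (1 - u) * (v - u) * sb_weight (Suc n) u v)"
    unfolding sb_at_def collapse_mult
    by (subst collapse_Suc) (simp add: mult.left_commute)
  also have "collapse (\<lambda>n. (1 - u) * (v - u) * sb_weight (Suc n) u v)
      = (1 - u) * (v - u) * (u * v) + u * v * (v - u) * (sb_at 1 v - sb_at u v)
        + u * v * (1 - u) * (sb_at u v - sb_at u u)"
    unfolding sb_weight_functional collapse_add collapse_mult collapse_diff at_zero sb_at_def ..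
  finally show ?thesis by (simp add: algebra_simps)
qed

text \<open>
  Collecting the terms with \<open>S(1 + \<alpha>, \<zeta>)\<close> in the functional equation gives the kernel as coefficient.
  If it vanishes, a relation between the univariate series \<open>S(1, \<zeta>)\<close> and \<open>S(1 + \<alpha>, 1 + \<alpha>)\<close> is left.
\<close>

lemma kernel_method:
  fixes \<alpha> \<zeta> :: "'c::idom fps"
  assumes kernel: "\<alpha> * (\<zeta> - 1 - \<alpha>) = fps_X * \<zeta> * (\<zeta> - 1) * (1 + \<alpha>)"
    and nz: "\<zeta> \<noteq> 0" "1 + \<alpha> \<noteq> 0"
  shows "(\<zeta> - 1 - \<alpha>) * sb_at 1 \<zeta> + \<alpha> * sb_at (1 + \<alpha>) (1 + \<alpha>) = \<alpha> * (\<zeta> - 1 - \<alpha>)"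
proof -
  define s A B where "s = sb_at (1 + \<alpha>) \<zeta>" and "A = sb_at 1 \<zeta>" and "B = sb_at (1 + \<alpha>) (1 + \<alpha>)"
  have "- \<alpha> * (\<zeta> - 1 - \<alpha>) * s
      = fps_X * ((1 + \<alpha>) * \<zeta>) * (- \<alpha> * (\<zeta> - 1 - \<alpha>) + (\<zeta> - 1 - \<alpha>) * (A - s) - \<alpha> * (s - B))"
    using sb_at_functional[of "1 + \<alpha>" \<zeta>] by (simp add: s_def A_def B_def algebra_simps)
  then have "fps_X * ((1 + \<alpha>) * \<zeta>) * ((\<zeta> - 1 - \<alpha>) * A + \<alpha> * B - \<alpha> * (\<zeta> - 1 - \<alpha>)) = 0"
    using kernel by algebra
  then show ?thesis using nz by (simp flip: A_def B_def)
qed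

text \<open>
  For fixed \<open>\<zeta>\<close> the kernel is quadratic in \<open>\<alpha>\<close>, for fixed \<open>\<alpha>\<close> it is quadratic in \<open>\<zeta>\<close>. Exchanging the two
  roots alternately, from \<open>(a, 1 + a + W)\<close> on, gives five pairs of series at which the kernel vanishes;
  the last has \<open>\<zeta> = 1 + 1/a\<close>. Neighbours share a coordinate, so the three intermediate pairs serve to
  eliminate all unknown series but \<open>S(1 + a, 1 + a)\<close> and \<open>S(1, 1 + 1/a)\<close>.
  The right-hand side is then reduced modulo the quadratic equation of \<open>V = W / (x * (1 + a))\<close>; dividing
  \<open>W\<close> by this factor avoids denominators.
\<close>

lemma orbit_relation:
  fixes t :: "'c::field" and W V :: "'c fps"
  defines "a \<equiv> fps_const t" and "x \<equiv> fps_X"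
  defines "q \<equiv> x * (1 + a)"
  defines "m \<equiv> a - q * (1 + 2 * a)"
  assumes t: "t \<noteq> 0" "1 + t \<noteq> 0"
    and W: "W = q * V" and V: "a * V = (W + 1 + a) * (W + a)" and nz: "W \<noteq> 0"
  shows "a ^ 5 * sb_at (1 + a) (1 + a) + a * x * (1 + a)^2 * sb_at 1 (1 + fps_const (inverse t))
    = a ^ 5 * x * (1 + a)^2 - (a^4 - 2*a^3 + a^2 - 1) * q * a * (1 + a) - a * (1 - a) * m * a * (1 + a)
    + (q^2 * (1 + 2*a^5) + q * m * (a^4 - 2*a^3 + a^2 - 1) + m^2 * a * (1 - a)
        - q^2 * a^2 * (1 + a) * (1 - a)) * V"
proof -
  define a' b s c where "a' = fps_const (inverse t)" and "b = fps_const (inverse (1 + t))"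
    and "s = 1 + a + W" and "c = inverse s"
  have [simp]: "fps_nth W 0 = 0" "fps_nth a 0 = t" "fps_nth a' 0 = inverse t"
      "fps_nth b 0 = inverse (1 + t)" "fps_nth c 0 = inverse (1 + t)" "fps_nth s 0 = 1 + t"
    by (simp_all add: W q_def x_def a_def a'_def b_def s_def c_def)
  have unit: "f \<noteq> 0" if "fps_nth f 0 \<noteq> 0" for f :: "'c fps"
    using that by (metis fps_zero_nth)
  have a': "a * a' = 1" using t by (simp add: a_def a'_def)
  have b: "b * (1 + a) = 1"
  proof -
    have "1 + a = fps_const (1 + t)" by (simp add: a_def flip: fps_const_1_eq_1)
    then show ?thesis using t by (simp add: b_def)
  qed
  have c: "c * s = 1" using t unfolding c_def by (intro inverse_mult_eq_1) simp
  have rel: "a * W = x * (1 + a) * s * (a + W)"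
    using V unfolding W s_def q_def by algebra
  note alg = a' b c rel s_def
  have nz': "a \<noteq> 0" "1 + a \<noteq> 0" "s \<noteq> 0" using t by (intro unit; simp)+
  define A0 A1 A2 b0 b1 b2 where "A0 = sb_at 1 (1 + a + W)" and "A1 = sb_at 1 (1 + W * a')"
    and "A2 = sb_at 1 (1 + a')" and "b0 = sb_at (1 + a) (1 + a)"
    and "b1 = sb_at (1 + W * b) (1 + W * b)" and "b2 = sb_at (1 + W * a' * c) (1 + W * a' * c)"
  \<comment> \<open>the pair \<open>(a, 1 + a + W)\<close>; the denominators are cleared here and in the other four cases\<close>
  have E1: "W * A0 + a * b0 = a * W"
  proof -
    have "a * (1 + a + W - 1 - a) = x * (1 + a + W) * (1 + a + W - 1) * (1 + a)"
      using rel unfolding s_def by algebra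
    from kernel_method[OF this[unfolded x_def]] t show ?thesis
      by (simp add: A0_def b0_def unit algebra_simps)
  qed
  \<comment> \<open>the pair \<open>(W / (1 + a), 1 + a + W)\<close>\<close>
  have E2: "(1 + a) * (a * s * A0 + W * b1) = a * s * W"
  proof -
    have \<delta>: "1 + a + W - 1 - W * b = a * s * b" using alg by algebra
    have "W * b * (1 + a + W - 1 - W * b) = x * (1 + a + W) * (1 + a + W - 1) * (1 + W * b)"
      using alg by algebra
    from kernel_method[OF this[unfolded x_def]] t
    have "a * s * b * A0 + W * b * b1 = W * b * (a * s * b)"
      unfolding \<delta> by (simp add: A0_def b1_def unit)
    then show ?thesis using b by algebra
  qed
  \<comment> \<open>the pair \<open>(W / (1 + a), 1 + W / a)\<close>\<close>
  have E3: "(1 + a) * (A1 + a * b1) = W"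
  proof -
    have \<delta>: "1 + W * a' - 1 - W * b = W * a' * b" using alg by algebra
    have "W * b * (1 + W * a' - 1 - W * b) = x * (1 + W * a') * (1 + W * a' - 1) * (1 + W * b)"
      using alg by algebra
    from kernel_method[OF this[unfolded x_def]] t
    have "W * a' * b * A1 + W * b * b1 = W * b * (W * a' * b)"
      unfolding \<delta> by (simp add: A1_def b1_def unit)
    then have "W * ((1 + a) * (A1 + a * b1)) = W * W" using a' b by algebra
    then show ?thesis using nz by simp
  qed
  \<comment> \<open>the pair \<open>(W / (a * (1 + a + W)), 1 + W / a)\<close>\<close>
  have E4: "a * s * ((a + W) * A1 + b2) = W * (a + W)"
  proof -
    have \<delta>: "1 + W * a' - 1 - W * a' * c = W * a' * (a + W) * c" using alg by algebra
    have "W * a' * c * (1 + W * a' - 1 - W * a' * c)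
        = x * (1 + W * a') * (1 + W * a' - 1) * (1 + W * a' * c)"
      using alg by algebra
    from kernel_method[OF this[unfolded x_def]] t
    have "W * a' * (a + W) * c * A1 + W * a' * c * b2 = W * a' * c * (W * a' * (a + W) * c)"
      unfolding \<delta> by (simp add: A1_def b2_def unit)
    then have "W * (a * s * ((a + W) * A1 + b2)) = W * (W * (a + W))" using a' c by algebra
    then show ?thesis using nz by simp
  qed
  \<comment> \<open>the pair \<open>(W / (a * (1 + a + W)), 1 + 1 / a)\<close>\<close>
  have E5: "a * s * ((1 + a) * A2 + W * b2) = W * (1 + a)"
  proof -
    have \<delta>: "1 + a' - 1 - W * a' * c = (1 + a) * a' * c" using alg by algebra
    have "W * a' * c * (1 + a' - 1 - W * a' * c) = x * (1 + a') * (1 + a' - 1) * (1 + W * a' * c)"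
      using alg by algebra
    moreover have "1 + a' = (1 + a) * a'" using a' by algebra
    then have "1 + a' \<noteq> 0" using nz'(2) a' by auto
    ultimately have "(1 + a) * a' * c * A2 + W * a' * c * b2 = W * a' * c * ((1 + a) * a' * c)"
      using kernel_method[of "W * a' * c" "1 + a'"] unfolding \<delta> x_def
      by (simp add: A2_def b2_def unit)
    then show ?thesis using a' c by algebra
  qed
  \<comment> \<open>what remains of the right-hand side after \<open>A0\<close>, \<open>b1\<close>, \<open>A1\<close>, \<open>b2\<close> are eliminated in this order\<close>
  define N where "N = (a^3 * (1 + a) * s - a^2 * s * W + W^2) * a * s * (a + W)
    - W^2 * (1 + a) * (a + W) + W * (1 + a)^2"
  have "a^4 * (1 + a) * s^2 * (a + W) * b0 + W * (1 + a)^2 * a * s * A2 = W * N"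
  proof -
    have 1: "a^2 * (1 + a) * s * b0 = W * (a^2 * (1 + a) * s - a * s * W + (1 + a) * W * b1)"
      using E1 E2 by algebra
    have 2: "a^3 * (1 + a) * s * b0 = W * (a^3 * (1 + a) * s - a^2 * s * W + W * (W - (1 + a) * A1))"
      using 1 E3 by algebra
    have 3: "a^4 * (1 + a) * s^2 * (a + W) * b0 = W * ((a^3 * (1 + a) * s - a^2 * s * W + W^2) * a * s * (a + W)
        - W * (1 + a) * (W * (a + W) - a * s * b2))"
      using 2 E4 by algebra
    show ?thesis using 3 E5 unfolding N_def by algebra
  qed
  then have "W * (s * (a^5 * b0 + a * x * (1 + a)^2 * A2)) = W * (x * N)"
    using rel by algebra
  then have "s * (a^5 * b0 + a * x * (1 + a)^2 * A2) = x * N"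
    using nz by simp
  also have "x * N = s * (a ^ 5 * x * (1 + a)^2 - (a^4 - 2*a^3 + a^2 - 1) * q * a * (1 + a)
    - a * (1 - a) * m * a * (1 + a)
    + (q^2 * (1 + 2*a^5) + q * m * (a^4 - 2*a^3 + a^2 - 1) + m^2 * a * (1 - a)
        - q^2 * a^2 * (1 + a) * (1 - a)) * V)" (is "_ = s * ?F")
  proof -
    have Q: "q^2 * V^2 - m * V + a * (1 + a) = 0"
      using V unfolding W m_def by algebra
    \<comment> \<open>the quotient of the difference by the quadratic polynomial of \<open>V\<close>\<close>
    define \<kappa> where "\<kappa> = (a^2 - a^4)
      + x * (- 1 - 3 * a - 3 * a^2 - a^3 + a^4 + 2 * a^5 + a^6)
      + x * V * (a^2 - a^4)
      + x^2 * V * (- 1 - 2 * a - a^2 - a^3 - a^4 + a^5 + a^6)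
      + x^3 * V^2 * (a + 2 * a^2 - 2 * a^4 - a^5)"
    have "x * N - s * ?F = \<kappa> * (q^2 * V^2 - m * V + a * (1 + a))"
      unfolding \<kappa>_def N_def s_def W m_def q_def by algebra
    then show ?thesis unfolding Q by simp
  qed
  finally have "a^5 * b0 + a * x * (1 + a)^2 * A2 = ?F" using nz'(3) by simp
  then show ?thesis unfolding b0_def A2_def a'_def .
qed

section \<open>Linear differential equations from finite-dimensional spaces\<close>

text \<open>
  Gaussian elimination of one unknown per equation, without divisions.
\<close>

lemma underdetermined_system:
  fixes A :: "'b \<Rightarrow> 'j \<Rightarrow> 'p::idom"
  assumes "finite B" "finite J" "card B < card J"
  shows "\<exists>e. (\<exists>j\<in>J. e j \<noteq> 0) \<and> (\<forall>b\<in>B. (\<Sum>j\<in>J. A b j * e j) = 0)"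
  using assms
proof (induction B arbitrary: A J rule: finite_induct)
  case empty
  then obtain j where "j \<in> J" by fastforce
  then show ?case by (intro exI[of _ "\<lambda>_. 1"]) auto
next
  case (insert b B)
  show ?case
  proof (cases "\<forall>j\<in>J. A b j = 0")
    case True
    obtain e where e: "\<exists>j\<in>J. e j \<noteq> 0" "\<forall>b\<in>B. (\<Sum>j\<in>J. A b j * e j) = 0"
      using insert.IH[of J A] insert.prems insert.hyps by auto
    then show ?thesis using True by (intro exI[of _ e]) auto
  next
    case False
    then obtain i where i: "i \<in> J" "A b i \<noteq> 0" by blast
    define J' where "J' = J - {i}"
    have J': "finite J'" "card B < card J'" "J = insert i J'" "i \<notin> J'"
      using insert.prems insert.hyps i by (auto simp: J'_def)
    obtain e where e: "\<exists>j\<in>J'. e j \<noteq> 0"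
        "\<forall>c\<in>B. (\<Sum>j\<in>J'. (A b i * A c j - A c i * A b j) * e j) = 0"
      using insert.IH[OF J'(1,2), of "\<lambda>c j. A b i * A c j - A c i * A b j"] by blast
    define e' where "e' j = (if j = i then - (\<Sum>j\<in>J'. A b j * e j) else A b i * e j)" for j
    have row: "(\<Sum>j\<in>J. A c j * e' j) = (\<Sum>j\<in>J'. (A b i * A c j - A c i * A b j) * e j)" for c
    proof -
      have "(\<Sum>j\<in>J'. A c j * e' j) = (\<Sum>j\<in>J'. A b i * A c j * e j)"
        using J'(4) by (intro sum.cong) (auto simp: e'_def)
      then have "(\<Sum>j\<in>J. A c j * e' j) = (\<Sum>j\<in>J'. A b i * A c j * e j) - A c i * (\<Sum>j\<in>J'. A b j * e j)"
        using J' by (simp add: e'_def)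
      then show ?thesis by (simp add: sum_distrib_left sum_subtractf left_diff_distrib mult.assoc)
    qed
    have "\<exists>j\<in>J. e' j \<noteq> 0" using e(1) J' i(2) by (auto simp: e'_def)
    moreover have "(\<Sum>j\<in>J. A c j * e' j) = 0" if "c \<in> insert b B" for c
      using that e(2) unfolding row by (auto simp: mult.commute)
    ultimately show ?thesis by blast
  qed
qed

text \<open>
  The elements of the series ring that become polynomial combinations of \<open>B\<close> after multiplication by a
  nonzero polynomial, that is, the span of \<open>B\<close> over the field of rational functions. The cancellation
  rule replaces this field, which does not act on the series ring.
\<close>

inductive_set ratspan :: "('p::zero \<Rightarrow> 's::comm_ring_1) \<Rightarrow> 's set \<Rightarrow> 's set"
  for emb B where
  base: "b \<in> B \<Longrightarrow> b \<in> ratspan emb B"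
| zero: "0 \<in> ratspan emb B"
| add: "f \<in> ratspan emb B \<Longrightarrow> g \<in> ratspan emb B \<Longrightarrow> f + g \<in> ratspan emb B"
| scale: "f \<in> ratspan emb B \<Longrightarrow> emb p * f \<in> ratspan emb B"
| cancel: "emb p * f \<in> ratspan emb B \<Longrightarrow> p \<noteq> 0 \<Longrightarrow> f \<in> ratspan emb B"

locale poly_embedding =
  fixes emb :: "'p::idom \<Rightarrow> 's::comm_ring_1"
  assumes emb_add: "emb (p + q) = emb p + emb q"
    and emb_mult: "emb (p * q) = emb p * emb q"
    and emb_1: "emb 1 = 1"
begin

lemma emb_0: "emb 0 = 0"
  using emb_add[of 0 0] by simp

lemma emb_minus: "emb (- p) = - emb p"
  using emb_add[of p "- p"] by (simp add: emb_0 minus_unique)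

lemma emb_sum: "emb (sum f X) = (\<Sum>x\<in>X. emb (f x))"
  by (induction X rule: infinite_finite_induct) (simp_all add: emb_0 emb_add)

lemma ratspan_minus: "f \<in> ratspan emb B \<Longrightarrow> - f \<in> ratspan emb B"
  using ratspan.scale[of f emb B "- 1"] by (simp add: emb_minus emb_1)

lemma ratspan_diff: "f \<in> ratspan emb B \<Longrightarrow> g \<in> ratspan emb B \<Longrightarrow> f - g \<in> ratspan emb B"
  using ratspan.add[OF _ ratspan_minus] by fastforce

lemma ratspan_relation:
  assumes "finite B" "f \<in> ratspan emb B"
  shows "\<exists>p c. p \<noteq> 0 \<and> emb p * f = (\<Sum>b\<in>B. emb (c b) * b)"
  using assms(2)
proof induction
  case (base b)
  then show ?case using assms(1)
    by (intro exI[of _ 1] exI[of _ "\<lambda>x. if x = b then 1 else 0"])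
      (simp add: emb_0 emb_1 if_distrib[of emb] if_distrib[of "\<lambda>t. t * _"] cong: if_cong)
next
  case zero
  then show ?case by (intro exI[of _ 1] exI[of _ "\<lambda>_. 0"]) (simp add: emb_0)
next
  case (add f g)
  then obtain p c q d where *: "p \<noteq> 0" "emb p * f = (\<Sum>b\<in>B. emb (c b) * b)"
    "q \<noteq> 0" "emb q * g = (\<Sum>b\<in>B. emb (d b) * b)" by blast
  have "emb (p * q) * (f + g) = emb q * (emb p * f) + emb p * (emb q * g)"
    by (simp add: emb_mult algebra_simps)
  also have "\<dots> = (\<Sum>b\<in>B. emb (q * c b + p * d b) * b)"
    unfolding * by (simp add: sum_distrib_left emb_add emb_mult distrib_right mult.assoc sum.distrib)
  finally show ?case using *(1,3)
    by (intro exI[of _ "p * q"] exI[of _ "\<lambda>b. q * c b + p * d b"]) simp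
next
  case (scale f r)
  then obtain p c where *: "p \<noteq> 0" "emb p * f = (\<Sum>b\<in>B. emb (c b) * b)" by blast
  have "emb p * (emb r * f) = (\<Sum>b\<in>B. emb (r * c b) * b)"
    using *(2) by (simp add: mult.left_commute[of "emb p"] sum_distrib_left emb_mult mult.assoc)
  then show ?case using *(1) by (intro exI[of _ p] exI[of _ "\<lambda>b. r * c b"]) simp
next
  case (cancel r f)
  then obtain p c where *: "p \<noteq> 0" "emb p * (emb r * f) = (\<Sum>b\<in>B. emb (c b) * b)" by blast
  then show ?case using cancel(2)
    by (intro exI[of _ "p * r"] exI[of _ c]) (simp add: emb_mult mult.assoc)
qed

end

locale differential_embedding = poly_embedding emb
  for emb :: "'p::idom \<Rightarrow> 's::comm_ring_1" +
  fixes D :: "'s \<Rightarrow> 's"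
  assumes D_add: "D (f + g) = D f + D g"
    and D_mult: "D (f * g) = D f * g + f * D g"
    and D_emb: "\<exists>q. D (emb p) = emb q"
begin

text \<open>
  A finite-dimensional space is closed under a derivation as soon as the basis is mapped into it.
\<close>

lemma ratspan_D:
  assumes "\<And>b. b \<in> B \<Longrightarrow> D b \<in> ratspan emb B" "f \<in> ratspan emb B"
  shows "D f \<in> ratspan emb B"
  using assms(2)
proof induction
  case zero
  have "D 0 = 0" using D_add[of 0 0] by simp
  then show ?case by (simp add: ratspan.zero)
next
  case (scale f p)
  obtain q where "D (emb p) = emb q" using D_emb by blast
  then show ?case using scale by (simp add: D_mult ratspan.add ratspan.scale)
next
  case (cancel p f)
  obtain q where "D (emb p) = emb q" using D_emb by blast
  then have "emb p * D f = D (emb p * f) - emb q * f" by (simp add: D_mult)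
  moreover have "f \<in> ratspan emb B" using cancel by (blast intro: ratspan.cancel)
  ultimately have "emb p * D f \<in> ratspan emb B"
    using cancel by (simp add: ratspan_diff ratspan.scale)
  then show ?case using cancel by (blast intro: ratspan.cancel)
qed (simp_all add: assms(1) D_add ratspan.add)

text \<open>
  The \<open>card B + 1\<close> elements \<open>f\<close>, \<open>D f\<close>, \<dots> of a space spanned by \<open>card B\<close> elements are linearly
  dependent; a dependency is a differential equation.
\<close>

theorem ratspan_satisfies_linear_de:
  assumes "finite B" "\<And>b. b \<in> B \<Longrightarrow> D b \<in> ratspan emb B" "f \<in> ratspan emb B"
  shows "satisfies_linear_de emb D f"
proof -
  have "(D ^^ k) f \<in> ratspan emb B" for k
    by (induction k) (simp_all add: assms(3) ratspan_D[OF assms(2)])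
  then have "\<exists>p c. p \<noteq> 0 \<and> emb p * (D ^^ k) f = (\<Sum>b\<in>B. emb (c b) * b)" for k
    using ratspan_relation[OF assms(1)] by blast
  then obtain p c where p: "p k \<noteq> 0"
    and c: "emb (p k) * (D ^^ k) f = (\<Sum>b\<in>B. emb (c k b) * b)" for k
    by metis
  obtain e where e: "\<exists>k\<le>card B. e k \<noteq> 0" "\<forall>b\<in>B. (\<Sum>k\<le>card B. c k b * e k) = 0"
    using underdetermined_system[of B "{..card B}" "\<lambda>b k. c k b"] assms(1) by auto
  have "(\<Sum>k\<le>card B. emb (e k * p k) * (D ^^ k) f) = (\<Sum>k\<le>card B. \<Sum>b\<in>B. emb (c k b * e k) * b)"
  proof (rule sum.cong[OF refl])
    fix k
    have "emb (e k * p k) * (D ^^ k) f = emb (e k) * (\<Sum>b\<in>B. emb (c k b) * b)"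
      using c[of k] by (simp add: emb_mult mult.assoc)
    then show "emb (e k * p k) * (D ^^ k) f = (\<Sum>b\<in>B. emb (c k b * e k) * b)"
      by (simp add: sum_distrib_left emb_mult mult_ac)
  qed
  also have "\<dots> = (\<Sum>b\<in>B. emb (\<Sum>k\<le>card B. c k b * e k) * b)"
    by (subst sum.swap) (simp add: emb_sum sum_distrib_right)
  also have "\<dots> = 0" using e(2) by (simp add: emb_0)
  finally show ?thesis unfolding satisfies_linear_de_def using e(1) p
    by (intro exI[of _ "card B"] exI[of _ "\<lambda>k. e k * p k"]) auto
qed

end

section \<open>The algebraic series\<close>

text \<open>
  Series in \<open>x\<close> whose coefficients are Laurent series in \<open>a\<close>. They contain \<open>1/a\<close>, and their coefficients at
  powers of \<open>a\<close> can be extracted one by one.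
\<close>

abbreviation var_x :: "rat fls fps" where "var_x \<equiv> fps_X"
abbreviation var_a :: "rat fls fps" where "var_a \<equiv> fps_const fls_X"

text \<open>
  With \<open>W = x * (1 + a) * V\<close> the equation expresses \<open>x\<close> as a power series in \<open>W\<close> without constant term
  and with invertible linear coefficient, so \<open>W\<close> is its compositional inverse.
\<close>

lemma kernel_root_exists:
  "\<exists>V. var_a * V = (var_x * (1 + var_a) * V + 1 + var_a) * (var_x * (1 + var_a) * V + var_a)"
proof -
  let ?t = "fls_X :: rat fls"
  have t: "?t \<noteq> 0" "1 + ?t \<noteq> 0"
  proof -
    have "fls_nth (1 + ?t) 0 \<noteq> 0" by simp
    then show "1 + ?t \<noteq> 0" by (metis fls_zero_nth)
  qed simp
  define h where "h = (1 + var_a) * (var_x + 1 + var_a) * (var_x + var_a)"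
  define g where "g = var_a * var_x * inverse h"
  define W where "W = fps_inv g"
  have h0: "fps_nth h 0 \<noteq> 0" using t by (simp add: h_def)
  have gh: "g * h = var_a * var_x"
    using inverse_mult_eq_1[OF h0] by (simp add: g_def mult.assoc)
  have g: "fps_nth g 0 = 0" "fps_nth g 1 \<noteq> 0"
  proof -
    have "g = fps_X * (var_a * inverse h)" by (simp add: g_def mult_ac)
    then show "fps_nth g 0 = 0" "fps_nth g 1 \<noteq> 0" using h0 t by simp_all
  qed
  have W0: "fps_nth W 0 = 0" by (simp add: W_def fps_inv_def)
  have "(g * h) oo W = var_a * W"
    unfolding gh using W0 by (simp add: fps_compose_mult_distrib)
  moreover have "g oo W = var_x" unfolding W_def by (rule fps_inv_right[OF g])
  moreover have "h oo W = (1 + var_a) * (W + 1 + var_a) * (W + var_a)"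
    unfolding h_def using W0 by (simp add: fps_compose_mult_distrib fps_compose_add_distrib)
  ultimately have W: "var_a * W = var_x * ((1 + var_a) * (W + 1 + var_a) * (W + var_a))"
    using W0 by (simp add: fps_compose_mult_distrib)
  define V where "V = fps_const (inverse (1 + ?t)) * fps_shift 1 W"
  have shift: "fps_X * fps_shift 1 W = W"
    by (rule fps_ext) (simp add: W0 split: nat.split)
  have unit: "(1 + var_a) * fps_const (inverse (1 + ?t)) = 1"
  proof -
    have "1 + var_a = fps_const (1 + ?t)" by (simp flip: fps_const_1_eq_1)
    then show ?thesis using t by simp
  qed
  have V: "var_x * (1 + var_a) * V = W"
  proof -
    have "var_x * (1 + var_a) * V
        = (var_x * fps_shift 1 W) * ((1 + var_a) * fps_const (inverse (1 + ?t)))"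
      unfolding V_def by (simp only: mult_ac)
    then show ?thesis unfolding shift unit by simp
  qed
  have "1 + var_a \<noteq> 0" using unit by auto
  have "var_x * (1 + var_a) * (var_a * V) = var_x * (1 + var_a) * ((W + 1 + var_a) * (W + var_a))"
    using W V by algebra
  then have "var_a * V = (W + 1 + var_a) * (W + var_a)"
    using \<open>1 + var_a \<noteq> 0\<close> by simp
  then show ?thesis unfolding V[symmetric] by blast
qed

definition deriv_a :: "rat fls fps \<Rightarrow> rat fls fps" where
  "deriv_a f = Abs_fps (\<lambda>n. fls_deriv (fps_nth f n))"

lemma deriv_a_nth [simp]: "fps_nth (deriv_a f) n = fls_deriv (fps_nth f n)"
  by (simp add: deriv_a_def)

lemma fls_deriv_sum: "fls_deriv (sum f X) = (\<Sum>x\<in>X. fls_deriv (f x))"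
  by (induction X rule: infinite_finite_induct) simp_all

lemma deriv_a_simps [simp]:
  "deriv_a 0 = 0" "deriv_a 1 = 0" "deriv_a (numeral k) = 0" "deriv_a var_x = 0" "deriv_a var_a = 1"
  "deriv_a (f + g) = deriv_a f + deriv_a g" "deriv_a (f - g) = deriv_a f - deriv_a g"
  "deriv_a (f * g) = deriv_a f * g + f * deriv_a g"
  "deriv_a (f ^ 2) = 2 * f * deriv_a f"
proof -
  show mult: "deriv_a (f * g) = deriv_a f * g + f * deriv_a g" for f g
    by (rule fps_ext) (simp add: fps_mult_nth fls_deriv_sum sum.distrib add.commute)
  show "deriv_a (f ^ 2) = 2 * f * deriv_a f"
    by (simp add: power2_eq_square mult)
qed (auto simp: fps_eq_iff numeral_fps_const fps_X_def)

text \<open>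
  The assumptions say that \<open>V\<close> is a root of a quadratic polynomial and that its derivative \<open>V'\<close>
  by \<open>a\<close> satisfies the differentiated equation. The left-hand factor is \<open>2 * (1 + a)\<close> times the
  discriminant \<open>x^2 * (1 + a)^2 - 2 * a * x * (1 + a) * (1 + 2 * a) + a^2\<close>, expanded in powers of \<open>a\<close> so
  that a recurrence for the coefficients of \<open>V\<close> can be read off. The last assumption excludes a double
  root.
\<close>

lemma root_ode_a:
  fixes a x V V' :: "'r::idom"
  assumes root: "x^2 * (1 + a)^2 * V^2 - (a - x * (1 + a) * (1 + 2*a)) * V + a * (1 + a) = 0"
    and diff: "2 * x^2 * (1 + a) * V^2 + 2 * x^2 * (1 + a)^2 * V * V' - (1 - x * (3 + 4*a)) * V
      - (a - x * (1 + a) * (1 + 2*a)) * V' + 1 + 2*a = 0"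
    and nz: "2 * x^2 * (1 + a)^2 * V - (a - x * (1 + a) * (1 + 2*a)) \<noteq> 0"
  shows "2 * (x^2 + a * (3*x^2 - 2*x) + a^2 * (3*x^2 - 8*x + 1) + a^3 * (x^2 - 10*x + 1) - a^4 * (4*x)) * V'
    = (a^3 * (4*x) - a^2 * (2*x^2 + 2) + a * (2 - 6*x - 4*x^2) - (2*x^2 + 2*x)) * V
    + (1 + a) * (2 * (a - x * (1 + a) * (1 + 2*a)) * (1 + 4*a) - 4 * a * (1 + a) * (1 - x * (3 + 4*a)))"
  (is "?L = ?R")
proof -
  have "(2 * x^2 * (1 + a)^2 * V - (a - x * (1 + a) * (1 + 2*a))) * (?L - ?R) = 0"
    using root diff by algebra
  then show ?thesis using nz by simp
qed

text \<open>
  The derivative \<open>V''\<close> by \<open>x\<close> has the discriminant of the quadratic as denominator. Over the rational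
  functions in \<open>x\<close> the discriminant is a cubic in \<open>a\<close> coprime to \<open>1 + a\<close> times its own derivative, and a
  Bezout identity for the two trades that denominator for the derivative \<open>V'\<close> by \<open>a\<close> and a factor in
  \<open>x\<close> alone. Hence extracting a coefficient at a power of \<open>a\<close> commutes with the left-hand factor.
\<close>

lemma root_ode_x:
  fixes a x V V' V'' :: "'r::idom"
  assumes root: "x^2 * (1 + a)^2 * V^2 - (a - x * (1 + a) * (1 + 2*a)) * V + a * (1 + a) = 0"
    and diff_a: "2 * x^2 * (1 + a) * V^2 + 2 * x^2 * (1 + a)^2 * V * V' - (1 - x * (3 + 4*a)) * V
      - (a - x * (1 + a) * (1 + 2*a)) * V' + 1 + 2*a = 0"
    and diff_x: "2 * x * (1 + a)^2 * V^2 + 2 * x^2 * (1 + a)^2 * V * V'' + (1 + a) * (1 + 2*a) * V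
      - (a - x * (1 + a) * (1 + 2*a)) * V'' = 0"
    and nz: "2 * x^2 * (1 + a)^2 * V - (a - x * (1 + a) * (1 + 2*a)) \<noteq> 0"
  shows "2 * x * (x^2 + 11*x - 1) * V''
    = ((1 - 17*x + 5*x^2 + x^3) + (3 - 3*x + 5*x^2 + x^3) * a - (6*x + 2*x^2) * a^2) * V
    + (1 + a) * ((6*x^2 + x^3 - x) + (3 - 25*x + x^2 + x^3) * a - (12*x + 4*x^2) * a^2) * V'
    + (1 + a) * ((6*x + x^2 - 1) - (6 + 2*x) * a)"
  (is "?L = ?R")
proof -
  have "(2 * x^2 * (1 + a)^2 * V - (a - x * (1 + a) * (1 + 2*a))) * (?L - ?R) = 0"
    using root diff_a diff_x by algebra
  then show ?thesis using nz by simp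
qed

locale kernel_root =
  fixes V :: "rat fls fps"
  assumes V: "var_a * V = (var_x * (1 + var_a) * V + 1 + var_a) * (var_x * (1 + var_a) * V + var_a)"
begin

lemma quadratic:
  "var_x^2 * (1 + var_a)^2 * V^2 - (var_a - var_x * (1 + var_a) * (1 + 2*var_a)) * V
    + var_a * (1 + var_a) = 0"
  using V by algebra

lemma discriminant_nonzero:
  "2 * var_x^2 * (1 + var_a)^2 * V - (var_a - var_x * (1 + var_a) * (1 + 2*var_a)) \<noteq> 0" (is "?s \<noteq> 0")
proof -
  have "fps_nth ?s 0 = - fls_X" by (simp add: power2_eq_square mult.assoc)
  then show ?thesis by (metis fps_zero_nth fls_X_nonzero neg_equal_0_iff_equal)
qed

lemma quadratic_deriv_a:
  "2 * var_x^2 * (1 + var_a) * V^2 + 2 * var_x^2 * (1 + var_a)^2 * V * deriv_a V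
    - (1 - var_x * (3 + 4*var_a)) * V - (var_a - var_x * (1 + var_a) * (1 + 2*var_a)) * deriv_a V
    + 1 + 2*var_a = 0"
  using arg_cong[OF quadratic, of deriv_a] by simp algebra

lemma quadratic_deriv_x:
  "2 * var_x * (1 + var_a)^2 * V^2 + 2 * var_x^2 * (1 + var_a)^2 * V * fps_deriv V
    + (1 + var_a) * (1 + 2*var_a) * V
    - (var_a - var_x * (1 + var_a) * (1 + 2*var_a)) * fps_deriv V = 0"
  using arg_cong[OF quadratic, of fps_deriv] by (simp add: power2_eq_square) algebra

lemmas ode_a = root_ode_a[OF quadratic quadratic_deriv_a discriminant_nonzero]
lemmas ode_x = root_ode_x[OF quadratic quadratic_deriv_a quadratic_deriv_x discriminant_nonzero]

end

section \<open>Coefficient extraction and the nonnegative part\<close>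

definition coef :: "int \<Rightarrow> rat fls fps \<Rightarrow> rat fps" where
  "coef j f = Abs_fps (\<lambda>n. fls_nth (fps_nth f n) j)"

definition nonneg :: "rat fls fps \<Rightarrow> rat fps fps" where
  "nonneg f = Abs_fps (\<lambda>n. fls_regpart (fps_nth f n))"

text \<open>
  A series in \<open>x\<close> as a series in \<open>x\<close> and \<open>a\<close>.
\<close>

definition fps_x :: "rat fps \<Rightarrow> rat fps fps" where
  "fps_x c = Abs_fps (\<lambda>n. fps_const (fps_nth c n))"

definition poly_x :: "rat poly \<Rightarrow> rat fls fps" where
  "poly_x p = Abs_fps (\<lambda>n. fls_const (coeff p n))"

lemma coef_nth [simp]: "fps_nth (coef j f) n = fls_nth (fps_nth f n) j"
  by (simp add: coef_def)

lemma nonneg_nth [simp]: "fps_nth (nonneg f) n = fls_regpart (fps_nth f n)"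
  by (simp add: nonneg_def)

lemma fps_x_nth [simp]: "fps_nth (fps_x c) n = fps_const (fps_nth c n)"
  by (simp add: fps_x_def)

lemma coef_simps [simp]:
  "coef j 0 = 0" "coef j 1 = (if j = 0 then 1 else 0)"
  "coef j (f + g) = coef j f + coef j g" "coef j (f - g) = coef j f - coef j g"
  "coef j (- f) = - coef j f"
  "coef j (var_x * f) = fps_X * coef j f" "coef j (var_a * f) = coef (j - 1) f"
  "coef j (fps_const fls_X_inv * f) = coef (j + 1) f"
  "coef j (deriv_a f) = fps_const (of_int (j + 1)) * coef (j + 1) f"
  by (auto simp: fps_eq_iff fls_X_times_conv_shift fls_X_inv_times_conv_shift)

lemma coef_poly_x [simp]: "coef j (poly_x p * f) = fps_of_poly p * coef j f"
  by (rule fps_ext) (simp add: fps_mult_nth fls_nth_sum poly_x_def)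

lemma poly_x_simps: "poly_x 0 = 0" "poly_x (pCons c p) = fps_const (fls_const c) + var_x * poly_x p"
  by (auto simp: fps_eq_iff poly_x_def coeff_pCons split: nat.split)

lemma coef_power_a [simp]: "coef j (var_a ^ k * f) = coef (j - int k) f"
proof (induction k arbitrary: j)
  case (Suc k)
  have "coef j (var_a ^ Suc k * f) = coef (j - 1) (var_a ^ k * f)"
    by (simp only: power_Suc mult.assoc coef_simps)
  moreover have "j - 1 - int k = j - int (Suc k)" by simp
  ultimately show ?case unfolding Suc.IH by (simp only:)
qed simp

lemma nonneg_simps [simp]:
  "nonneg 0 = 0" "nonneg 1 = 1" "nonneg (f + g) = nonneg f + nonneg g"
  "nonneg (f - g) = nonneg f - nonneg g" "nonneg (- f) = - nonneg f"
  "nonneg (var_x * f) = fps_X * nonneg f"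
  by (auto simp: fps_eq_iff)

text \<open>
  Taking the nonnegative part almost commutes with multiplication by \<open>a\<close>: the error is a single
  coefficient, which is a series in \<open>x\<close> alone.
\<close>

lemma nonneg_var_a: "nonneg (var_a * f) = fps_const fps_X * nonneg f + fps_x (coef (- 1) f)"
proof (rule fps_ext, rule fps_ext)
  fix n k
  show "fps_nth (fps_nth (nonneg (var_a * f)) n) k
      = fps_nth (fps_nth (fps_const fps_X * nonneg f + fps_x (coef (- 1) f)) n) k"
    by (cases k) (auto simp: fls_X_times_conv_shift)
qed

lemma fps_x_simps [simp]: "fps_x 0 = 0" "fps_x 1 = 1" "fps_x (c + d) = fps_x c + fps_x d"
  by (auto simp: fps_eq_iff)

lemma deriv_simps [simp]:
  "fps_deriv (coef j f) = coef j (fps_deriv f)"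
  "fps_deriv (nonneg f) = nonneg (fps_deriv f)"
  "fps_deriv (fps_x c) = fps_x (fps_deriv c)"
  "fps_deriv_inner (nonneg f) = nonneg (deriv_a f)"
  "fps_deriv_inner (fps_x c) = 0"
  by (auto simp: fps_eq_iff fps_deriv_inner_def fls_of_nat fps_of_nat[symmetric] add.commute)

lemma fps2_of_poly2_nth [simp]: "fps_nth (fps2_of_poly2 q) n = fps_of_poly (coeff q n)"
  by (simp add: fps2_of_poly2_def coeff_map_poly)

interpretation x_series: differential_embedding "fps_of_poly :: rat poly \<Rightarrow> rat fps" fps_deriv
proof
  show "\<exists>q. fps_deriv (fps_of_poly p) = fps_of_poly q" for p :: "rat poly"
    by (metis fps_of_poly_pderiv)
qed (simp_all add: fps_of_poly_add fps_of_poly_mult algebra_simps)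

lemma fps_of_poly_of_nat: "fps_of_poly (of_nat n) = (of_nat n :: rat fps)"
  by (induction n) (simp_all add: fps_of_poly_add)

interpretation xa_series: poly_embedding "fps2_of_poly2 :: rat poly poly \<Rightarrow> rat fps fps"
  by standard
    (auto simp: fps_eq_iff fps_mult_nth coeff_mult fps_of_poly_add fps_of_poly_mult fps_of_poly_sum
      atLeast0AtMost coeff_sum fps_sum_nth)

interpretation xa_series_x: differential_embedding "fps2_of_poly2 :: rat poly poly \<Rightarrow> rat fps fps" fps_deriv
proof
  fix p :: "rat poly poly"
  have "fps_deriv (fps2_of_poly2 p) = fps2_of_poly2 (pderiv p)"
    by (rule fps_ext) (simp add: coeff_pderiv fps_of_poly_mult fps_of_poly_add fps_of_poly_of_nat)
  then show "\<exists>q. fps_deriv (fps2_of_poly2 p) = fps2_of_poly2 q" by blast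
qed (simp_all add: algebra_simps)

interpretation xa_series_a: differential_embedding "fps2_of_poly2 :: rat poly poly \<Rightarrow> rat fps fps" fps_deriv_inner
proof
  fix p :: "rat poly poly" and f g :: "rat fps fps"
  have "fps_deriv_inner (fps2_of_poly2 p) = fps2_of_poly2 (map_poly pderiv p)"
    by (rule fps_ext) (simp add: fps_deriv_inner_def coeff_map_poly fps_of_poly_pderiv)
  then show "\<exists>q. fps_deriv_inner (fps2_of_poly2 p) = fps2_of_poly2 q" by blast
  show "fps_deriv_inner (f + g) = fps_deriv_inner f + fps_deriv_inner g"
    by (rule fps_ext) (simp add: fps_deriv_inner_def)
  show "fps_deriv_inner (f * g) = fps_deriv_inner f * g + f * fps_deriv_inner g"
    by (rule fps_ext) (simp add: fps_deriv_inner_def fps_mult_nth fps_deriv_sum sum.distrib add.commute)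
qed

lemma fps_x_mult:
  "fps_x (fps_of_poly p * f) = fps2_of_poly2 (map_poly (\<lambda>c. [:c:]) p) * fps_x f"
proof (rule fps_ext, rule fps_ext)
  fix n k
  show "fps_nth (fps_nth (fps_x (fps_of_poly p * f)) n) k
      = fps_nth (fps_nth (fps2_of_poly2 (map_poly (\<lambda>c. [:c:]) p) * fps_x f) n) k"
    by (cases k) (simp_all add: fps_mult_nth fps_sum_nth coeff_map_poly fps_of_poly_const)
qed

text \<open>
  Links an element of the Laurent setting to the polynomial in \<open>x\<close> and \<open>a\<close> that it comes from; the rules
  follow the way an expression is written, so that the polynomial is found by backward chaining.
\<close>

inductive represents :: "rat fls fps \<Rightarrow> rat poly poly \<Rightarrow> bool" where
  x: "represents var_x [:0, 1:]"
| a: "represents var_a [:[:0, 1:]:]"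
| one: "represents 1 1"
| minus: "represents f p \<Longrightarrow> represents (- f) (- p)"
| add: "represents f p \<Longrightarrow> represents g q \<Longrightarrow> represents (f + g) (p + q)"
| mult: "represents f p \<Longrightarrow> represents g q \<Longrightarrow> represents (f * g) (p * q)"

lemma represents_diff: "represents f p \<Longrightarrow> represents g q \<Longrightarrow> represents (f - g) (p - q)"
  using represents.add[OF _ represents.minus] by fastforce

lemma represents_power: "represents f p \<Longrightarrow> represents (f ^ k) (p ^ k)"
  by (induction k) (simp_all add: represents.intros)

lemma represents_numeral: "represents (numeral k) (numeral k)"
proof (induction k)
  case (Bit0 k)
  then show ?case using represents.add by (simp only: numeral_Bit0)
next
  case (Bit1 k)
  then show ?case using represents.add represents.one by (simp only: numeral_Bit1)
qed (simp add: represents.one)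

lemmas represents_intros = represents.intros represents_diff represents_power represents_numeral

section \<open>Spaces closed under differentiation\<close>

context kernel_root
begin

text \<open>
  The differential equation of \<open>V\<close> in \<open>a\<close> is a recurrence of order four for the coefficients of \<open>V\<close> at
  the powers of \<open>a\<close>. Its leading coefficient vanishes only when the coefficient at \<open>a^0\<close> is to be
  computed, its trailing coefficient never; so the coefficients at \<open>a^0, \<dots>, a^(-3)\<close> determine all others.
\<close>

definition basis :: "rat fps set" where
  "basis = {1, coef 0 V, coef (- 1) V, coef (- 2) V, coef (- 3) V}"

abbreviation x_span :: "rat fps set" where "x_span \<equiv> ratspan fps_of_poly basis"

abbreviation xa_span :: "rat fps fps set" where
  "xa_span \<equiv> ratspan fps2_of_poly2 (insert (nonneg V) (fps_x ` basis))"

text \<open>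
  The two predicates single out the series from which D-finite series result by taking coefficients at
  powers of \<open>a\<close> and nonnegative parts.
\<close>

definition coefs_spanned :: "rat fls fps \<Rightarrow> bool" where
  "coefs_spanned f \<longleftrightarrow> (\<forall>j. coef j f \<in> x_span)"

definition spanned :: "rat fls fps \<Rightarrow> bool" where
  "spanned f \<longleftrightarrow> coefs_spanned f \<and> nonneg f \<in> xa_span"

lemma one_in_x_span: "1 \<in> x_span"
  by (rule ratspan.base) (simp add: basis_def)

lemma fps_X_in_x_span: "f \<in> x_span \<Longrightarrow> fps_X * f \<in> x_span"
  using ratspan.scale[of f fps_of_poly basis "[:0, 1:]"] by simp

lemma fps_x_in_xa_span: "c \<in> x_span \<Longrightarrow> fps_x c \<in> xa_span"
proof (induction rule: ratspan.induct)
  case (base b)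
  then show ?case by (blast intro: ratspan.base)
next
  case zero
  then show ?case by (simp add: ratspan.zero)
next
  case (add f g)
  then show ?case by (simp add: ratspan.add)
next
  case (scale f p)
  then show ?case by (simp add: fps_x_mult ratspan.scale)
next
  case (cancel p f)
  have "map_poly (\<lambda>c. [:c:]) p \<noteq> 0"
    using cancel(2) by (simp add: map_poly_eq_0_iff)
  then show ?case using cancel by (metis fps_x_mult ratspan.cancel)
qed

lemma coefs_spanned_one: "coefs_spanned 1"
  by (simp add: coefs_spanned_def one_in_x_span ratspan.zero)

lemma coefs_spanned_add: "coefs_spanned f \<Longrightarrow> coefs_spanned g \<Longrightarrow> coefs_spanned (f + g)"
  by (simp add: coefs_spanned_def ratspan.add)

lemma coefs_spanned_mult:
  assumes "represents p p'" "coefs_spanned f"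
  shows "coefs_spanned (p * f)"
  using assms
proof (induction arbitrary: f rule: represents.induct)
  case (add p p' q q')
  then show ?case by (simp add: coefs_spanned_add distrib_right)
next
  case (mult p p' q q')
  then show ?case by (simp add: mult.assoc)
qed (auto simp: coefs_spanned_def fps_X_in_x_span x_series.ratspan_minus)

text \<open>
  Iterating the commutation rule for \<open>a\<close> shows that the nonnegative part commutes with polynomial factors
  up to combinations of coefficients of \<open>f\<close>.
\<close>

lemma nonneg_mult:
  assumes "represents p p'" "coefs_spanned f"
  shows "nonneg (p * f) - fps2_of_poly2 p' * nonneg f \<in> xa_span"
  using assms
proof (induction arbitrary: f rule: represents.induct)
  case x
  have "fps2_of_poly2 [:0, 1:] = (fps_X :: rat fps fps)"
    by (rule fps_ext) (simp add: coeff_pCons fps_X_def split: nat.split)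
  then show ?case by (simp add: ratspan.zero)
next
  case a
  have "fps2_of_poly2 [:[:0, 1:]:] = fps_const (fps_X :: rat fps)"
    by (rule fps_ext) (simp add: coeff_pCons split: nat.split)
  then show ?case using a by (simp add: nonneg_var_a coefs_spanned_def fps_x_in_xa_span)
next
  case one
  then show ?case by (simp add: xa_series.emb_1 ratspan.zero)
next
  case (minus p p')
  then show ?case using xa_series.ratspan_minus[OF minus.IH[OF minus.prems]]
    by (simp add: xa_series.emb_minus algebra_simps)
next
  case (add p p' q q')
  show ?case using ratspan.add[OF add.IH(1)[OF add.prems] add.IH(2)[OF add.prems]]
    by (simp add: xa_series.emb_add algebra_simps)
next
  case (mult p p' q q')
  have "nonneg (p * (q * f)) - fps2_of_poly2 p' * nonneg (q * f) \<in> xa_span"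
    using mult coefs_spanned_mult by blast
  moreover have "fps2_of_poly2 p' * (nonneg (q * f) - fps2_of_poly2 q' * nonneg f) \<in> xa_span"
    using mult ratspan.scale by blast
  ultimately have "(nonneg (p * (q * f)) - fps2_of_poly2 p' * nonneg (q * f))
      + fps2_of_poly2 p' * (nonneg (q * f) - fps2_of_poly2 q' * nonneg f) \<in> xa_span"
    by (rule ratspan.add)
  then show ?case by (simp add: xa_series.emb_mult algebra_simps)
qed

lemma spanned_add: "spanned f \<Longrightarrow> spanned g \<Longrightarrow> spanned (f + g)"
  by (simp add: spanned_def coefs_spanned_add ratspan.add)

lemma spanned_mult:
  assumes "represents p p'" "spanned f"
  shows "spanned (p * f)"
proof -
  have "nonneg (p * f) - fps2_of_poly2 p' * nonneg f + fps2_of_poly2 p' * nonneg f \<in> xa_span"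
    using assms nonneg_mult by (intro ratspan.add ratspan.scale) (auto simp: spanned_def)
  then show ?thesis using assms coefs_spanned_mult by (simp add: spanned_def)
qed

lemma spanned_represents: "represents p p' \<Longrightarrow> spanned p"
  using spanned_mult[of p p' 1] fps_x_in_xa_span[OF one_in_x_span] by (simp add: spanned_def coefs_spanned_one)

lemma spanned_divide:
  assumes "represents p p'" "p' \<noteq> 0" "spanned (p * f)" "coefs_spanned f"
  shows "spanned f"
proof -
  have "nonneg (p * f) - (nonneg (p * f) - fps2_of_poly2 p' * nonneg f) \<in> xa_span"
    using nonneg_mult[OF assms(1,4)]
    by (rule xa_series.ratspan_diff[rotated]) (use assms(3) in \<open>simp add: spanned_def\<close>)
  then have "fps2_of_poly2 p' * nonneg f \<in> xa_span" by simp
  then have "nonneg f \<in> xa_span" using assms(2) by (rule ratspan.cancel)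
  then show ?thesis using assms by (simp add: spanned_def)
qed

lemma spanned_a_inverse: "spanned f \<Longrightarrow> spanned (fps_const fls_X_inv * f)"
proof (rule spanned_divide[OF represents.a])
  assume f: "spanned f"
  have "fls_X * fls_X_inv = (1 :: rat fls)"
    by (simp add: fls_X_times_conv_shift fls_X_inv_conv_shift_1)
  then have "var_a * (fps_const fls_X_inv * f) = f"
    by (simp flip: mult.assoc)
  then show "spanned (var_a * (fps_const fls_X_inv * f))" using f by (simp only:)
  show "coefs_spanned (fps_const fls_X_inv * f)" using f by (simp add: spanned_def coefs_spanned_def)
qed simp

text \<open>
  The coefficient of \<open>a^j\<close> in the differential equation of \<open>V\<close> by \<open>a\<close>; the inhomogeneous term only
  contributes polynomials in \<open>x\<close>.
\<close>

lemma recurrence: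
  "fps_of_poly (smult (of_int (2 * (j + 1))) [:0, 0, 1:]) * coef (j + 1) V
    + fps_of_poly (smult (of_int (2 * j)) [:0, - 2, 3:] + [:0, 2, 2:]) * coef j V
    + fps_of_poly (smult (of_int (2 * (j - 1))) [:1, - 8, 3:] - [:2, - 6, - 4:]) * coef (j - 1) V
    + fps_of_poly (smult (of_int (2 * (j - 2))) [:1, - 10, 1:] + [:2, 0, 2:]) * coef (j - 2) V
    + fps_of_poly (smult (of_int (2 * (j - 3))) [:0, - 4:] - [:0, 4:]) * coef (j - 3) V \<in> x_span"
  (is "?lhs \<in> _")
proof -
  define \<gamma> where "\<gamma> = (1 + var_a) * (2 * (var_a - var_x * (1 + var_a) * (1 + 2*var_a)) * (1 + 4*var_a)
    - 4 * var_a * (1 + var_a) * (1 - var_x * (3 + 4*var_a)))"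
  have "\<exists>p. represents \<gamma> p"
    unfolding \<gamma>_def by (rule exI, (rule represents_intros)+)
  then have "coef j \<gamma> \<in> x_span"
    using spanned_represents by (auto simp: spanned_def coefs_spanned_def)
  moreover have "?lhs = coef j \<gamma>"
  proof -
    have x: "poly_x [:0, 0, 1:] = var_x^2" "poly_x [:0, - 2, 3:] = 3*var_x^2 - 2*var_x"
      "poly_x [:1, - 8, 3:] = 3*var_x^2 - 8*var_x + 1" "poly_x [:1, - 10, 1:] = var_x^2 - 10*var_x + 1"
      "poly_x [:0, - 4:] = - (4*var_x)" "poly_x [:0, 2, 2:] = 2*var_x^2 + 2*var_x"
      "poly_x [:2, - 6, - 4:] = 2 - 6*var_x - 4*var_x^2" "poly_x [:2, 0, 2:] = 2*var_x^2 + 2"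
      "poly_x [:0, 4:] = 4*var_x"
      by (simp_all add: poly_x_simps power2_eq_square algebra_simps numeral_fps_const fps_const_neg
          flip: fls_const_numeral)
    have "poly_x [:0, 0, 1:] * deriv_a V + var_a ^ 1 * (poly_x [:0, - 2, 3:] * deriv_a V)
        + var_a ^ 2 * (poly_x [:1, - 8, 3:] * deriv_a V) + var_a ^ 3 * (poly_x [:1, - 10, 1:] * deriv_a V)
        + var_a ^ 4 * (poly_x [:0, - 4:] * deriv_a V)
      + (poly_x [:0, 0, 1:] * deriv_a V + var_a ^ 1 * (poly_x [:0, - 2, 3:] * deriv_a V)
        + var_a ^ 2 * (poly_x [:1, - 8, 3:] * deriv_a V) + var_a ^ 3 * (poly_x [:1, - 10, 1:] * deriv_a V)
        + var_a ^ 4 * (poly_x [:0, - 4:] * deriv_a V))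
      + poly_x [:0, 2, 2:] * V - var_a ^ 1 * (poly_x [:2, - 6, - 4:] * V)
        + var_a ^ 2 * (poly_x [:2, 0, 2:] * V) - var_a ^ 3 * (poly_x [:0, 4:] * V) = \<gamma>"
      unfolding \<gamma>_def x using ode_a by algebra
    then have "coef j (poly_x [:0, 0, 1:] * deriv_a V + var_a ^ 1 * (poly_x [:0, - 2, 3:] * deriv_a V)
        + var_a ^ 2 * (poly_x [:1, - 8, 3:] * deriv_a V) + var_a ^ 3 * (poly_x [:1, - 10, 1:] * deriv_a V)
        + var_a ^ 4 * (poly_x [:0, - 4:] * deriv_a V)
      + (poly_x [:0, 0, 1:] * deriv_a V + var_a ^ 1 * (poly_x [:0, - 2, 3:] * deriv_a V)
        + var_a ^ 2 * (poly_x [:1, - 8, 3:] * deriv_a V) + var_a ^ 3 * (poly_x [:1, - 10, 1:] * deriv_a V)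
        + var_a ^ 4 * (poly_x [:0, - 4:] * deriv_a V))
      + poly_x [:0, 2, 2:] * V - var_a ^ 1 * (poly_x [:2, - 6, - 4:] * V)
        + var_a ^ 2 * (poly_x [:2, 0, 2:] * V) - var_a ^ 3 * (poly_x [:0, 4:] * V)) = coef j \<gamma>"
      by (rule arg_cong)
    note * = this[unfolded coef_simps coef_poly_x coef_power_a]
    define D where "D i = fps_const (of_int i) * coef i V" for i
    have smult: "fps_of_poly (smult (of_int (2 * i)) p) * coef i V
        = fps_of_poly p * D i + fps_of_poly p * D i" for i p
      unfolding D_def fps_of_poly_smult of_int_mult fps_const_mult[symmetric]
      by (simp add: numeral_fps_const[symmetric])
    have "coef j \<gamma> = fps_of_poly [:0, 0, 1:] * D (j + 1) + fps_of_poly [:0, - 2, 3:] * D j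
        + fps_of_poly [:1, - 8, 3:] * D (j - 1) + fps_of_poly [:1, - 10, 1:] * D (j - 2)
        + fps_of_poly [:0, - 4:] * D (j - 3)
      + (fps_of_poly [:0, 0, 1:] * D (j + 1) + fps_of_poly [:0, - 2, 3:] * D j
        + fps_of_poly [:1, - 8, 3:] * D (j - 1) + fps_of_poly [:1, - 10, 1:] * D (j - 2)
        + fps_of_poly [:0, - 4:] * D (j - 3))
      + fps_of_poly [:0, 2, 2:] * coef j V - fps_of_poly [:2, - 6, - 4:] * coef (j - 1) V
        + fps_of_poly [:2, 0, 2:] * coef (j - 2) V - fps_of_poly [:0, 4:] * coef (j - 3) V"
    proof -
      have idx: "j - 1 + 1 = j" "j - 2 + 1 = j - 1" "j - 3 + 1 = j - 2" "j - int 1 + 1 = j" "j - int 2 + 1 = j - 1" "j - int 3 + 1 = j - 2" "j - int 4 + 1 = j - 3"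
        "j - int 1 = j - 1" "j - int 2 = j - 2" "j - int 3 = j - 3" by simp_all
      show ?thesis using *[symmetric] unfolding idx D_def[symmetric] .
    qed
    then show ?thesis
      unfolding fps_of_poly_add fps_of_poly_diff distrib_right left_diff_distrib smult
      by (simp only: add_ac add_diff_eq diff_add_eq diff_diff_eq2 diff_diff_add)
  qed
  ultimately show ?thesis by simp
qed

lemma coef_up: "coef (int k - 3) V \<in> x_span"
proof (induction k rule: less_induct)
  case (less k)
  show ?case
  proof (cases "k < 4")
    case True
    then have "k = 0 \<or> k = 1 \<or> k = 2 \<or> k = 3" by auto
    then show ?thesis by (auto intro!: ratspan.base simp: basis_def)
  next
    case False
    define j where "j = int k - 4"
    have IH: "coef (j - i) V \<in> x_span" if "0 \<le> i" "i \<le> 3" for i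
    proof -
      have "j - i = int (nat (int k - 1 - i)) - 3" "nat (int k - 1 - i) < k"
        using False that by (auto simp: j_def)
      then show ?thesis using less.IH by metis
    qed
    have IHs: "coef j V \<in> x_span" "coef (j - 1) V \<in> x_span" "coef (j - 2) V \<in> x_span" "coef (j - 3) V \<in> x_span"
      using IH[of 0] IH[of 1] IH[of 2] IH[of 3] by simp_all
    have "\<exists>g \<in> x_span. fps_of_poly (smult (of_int (2 * (j + 1))) [:0, 0, 1:]) * coef (j + 1) V + g \<in> x_span"
      using recurrence[of j] IHs unfolding add.assoc
      by (blast intro: ratspan.add ratspan.scale)
    then have "fps_of_poly (smult (of_int (2 * (j + 1))) [:0, 0, 1:]) * coef (j + 1) V \<in> x_span"
      using x_series.ratspan_diff by fastforce
    moreover have "smult (of_int (2 * (j + 1))) [:0, 0, 1:] \<noteq> (0 :: rat poly)"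
    proof -
      have "rat_of_int (2 * (j + 1)) \<noteq> 0" using False unfolding of_int_eq_0_iff by (simp add: j_def)
      then show ?thesis by (metis smult_eq_0_iff pCons_eq_0_iff one_neq_zero)
    qed
    ultimately have "coef (j + 1) V \<in> x_span" by (rule ratspan.cancel)
    moreover have "j + 1 = int k - 3" by (simp add: j_def)
    ultimately show ?thesis by simp
  qed
qed

lemma coef_down: "coef (- int k) V \<in> x_span"
proof (induction k rule: less_induct)
  case (less k)
  show ?case
  proof (cases "k < 4")
    case True
    then have "k = 0 \<or> k = 1 \<or> k = 2 \<or> k = 3" by auto
    then show ?thesis by (auto intro!: ratspan.base simp: basis_def)
  next
    case False
    define j where "j = 3 - int k"
    have IH: "coef (j - i) V \<in> x_span" if "-1 \<le> i" "i \<le> 2" for i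
    proof -
      have "j - i = - int (nat (int k - 3 + i))" "nat (int k - 3 + i) < k"
        using False that by (auto simp: j_def)
      then show ?thesis using less.IH by metis
    qed
    have IHs: "coef (j + 1) V \<in> x_span" "coef j V \<in> x_span" "coef (j - 1) V \<in> x_span" "coef (j - 2) V \<in> x_span"
      using IH[of "-1"] IH[of 0] IH[of 1] IH[of 2] by simp_all
    have "\<exists>g \<in> x_span. g + fps_of_poly (smult (of_int (2 * (j - 3))) [:0, - 4:] - [:0, 4:]) * coef (j - 3) V \<in> x_span"
      using recurrence[of j] IHs
      by (blast intro: ratspan.add ratspan.scale)
    then have "fps_of_poly (smult (of_int (2 * (j - 3))) [:0, - 4:] - [:0, 4:]) * coef (j - 3) V \<in> x_span"
      using x_series.ratspan_diff by fastforce
    \<comment> \<open>\<open>- 8 * (j - 3) = 4\<close> has no integer solution\<close>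
    moreover have "smult (of_int (2 * (j - 3))) [:0, - 4:] - [:0, 4:] \<noteq> (0 :: rat poly)"
    proof
      assume "smult (of_int (2 * (j - 3))) [:0, - 4:] - [:0, 4:] = (0 :: rat poly)"
      then have "coeff (smult (of_int (2 * (j - 3))) [:0, - 4:] - [:0, 4:]) 1 = (0 :: rat)" by simp
      then have "rat_of_int (- 8 * (j - 3) - 4) = rat_of_int 0" by simp
      then have "- 8 * (j - 3) - 4 = 0" by (simp only: of_int_eq_iff)
      then show False by presburger
    qed
    ultimately have "coef (j - 3) V \<in> x_span" by (rule ratspan.cancel)
    then show ?thesis by (simp add: j_def)
  qed
qed

lemma coefs_spanned_V: "coefs_spanned V"
  unfolding coefs_spanned_def
proof
  fix j
  show "coef j V \<in> x_span"
  proof (cases "j \<ge> 0")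
    case True
    then show ?thesis using coef_up[of "nat (j + 3)"] by simp
  next
    case False
    then show ?thesis using coef_down[of "nat (- j)"] by simp
  qed
qed

lemma spanned_V: "spanned V"
  using coefs_spanned_V by (simp add: spanned_def ratspan.base)

end

lemma poly_poly_nonzero: "poly (poly p u) v \<noteq> 0 \<Longrightarrow> p \<noteq> 0"
  by auto

context kernel_root
begin

lemma spanned_deriv_a: "spanned (deriv_a V)"
proof (rule spanned_divide)
  let ?x = "[:0, 1:] :: rat poly poly" and ?a = "[:[:0, 1:]:] :: rat poly poly"
  let ?p = "2 * (?x^2 + ?a * (3*?x^2 - 2*?x) + ?a^2 * (3*?x^2 - 8*?x + 1) + ?a^3 * (?x^2 - 10*?x + 1) - ?a^4 * (4*?x))"
  show "represents (2 * (var_x^2 + var_a * (3*var_x^2 - 2*var_x) + var_a^2 * (3*var_x^2 - 8*var_x + 1)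
      + var_a^3 * (var_x^2 - 10*var_x + 1) - var_a^4 * (4*var_x))) ?p"
    by (rule represents_intros)+
  \<comment> \<open>evaluation at \<open>x = 1\<close>, \<open>a = 0\<close>\<close>
  have "poly (poly ?p 1) 0 \<noteq> 0" by simp
  then show "?p \<noteq> 0" by (rule poly_poly_nonzero)
  have "\<exists>p. represents (var_a^3 * (4*var_x) - var_a^2 * (2*var_x^2 + 2) + var_a * (2 - 6*var_x - 4*var_x^2)
      - (2*var_x^2 + 2*var_x)) p"
    by (rule exI, (rule represents_intros)+)
  moreover have "\<exists>p. represents ((1 + var_a) * (2 * (var_a - var_x * (1 + var_a) * (1 + 2*var_a)) * (1 + 4*var_a)
      - 4 * var_a * (1 + var_a) * (1 - var_x * (3 + 4*var_a)))) p"
    by (rule exI, (rule represents_intros)+)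
  ultimately show "spanned (2 * (var_x^2 + var_a * (3*var_x^2 - 2*var_x) + var_a^2 * (3*var_x^2 - 8*var_x + 1)
      + var_a^3 * (var_x^2 - 10*var_x + 1) - var_a^4 * (4*var_x)) * deriv_a V)"
    unfolding ode_a by (blast intro: spanned_add spanned_mult spanned_represents spanned_V)
  have "coef j (deriv_a V) \<in> x_span" for j
  proof -
    have "coef j (deriv_a V) = fps_of_poly [:of_int (j + 1):] * coef (j + 1) V"
      by (simp only: coef_simps fps_of_poly_const)
    then show ?thesis using coefs_spanned_V by (simp only: coefs_spanned_def ratspan.scale)
  qed
  then show "coefs_spanned (deriv_a V)" by (simp only: coefs_spanned_def) blast
qed

lemma spanned_deriv_x: "spanned (fps_deriv V)"
proof (rule spanned_divide)
  let ?x = "[:0, 1:] :: rat poly poly"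
  let ?p = "2 * ?x * (?x^2 + 11*?x - 1)"
  show "represents (2 * var_x * (var_x^2 + 11*var_x - 1)) ?p"
    by (rule represents_intros)+
  \<comment> \<open>evaluation at \<open>x = 1\<close>, \<open>a = 0\<close>\<close>
  have "poly (poly ?p 1) 0 \<noteq> 0" by simp
  then show "?p \<noteq> 0" by (rule poly_poly_nonzero)
  have "\<exists>p. represents ((1 - 17*var_x + 5*var_x^2 + var_x^3) + (3 - 3*var_x + 5*var_x^2 + var_x^3) * var_a
      - (6*var_x + 2*var_x^2) * var_a^2) p"
    by (rule exI, (rule represents_intros)+)
  moreover have "\<exists>p. represents ((1 + var_a) * ((6*var_x^2 + var_x^3 - var_x)
      + (3 - 25*var_x + var_x^2 + var_x^3) * var_a - (12*var_x + 4*var_x^2) * var_a^2)) p"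
    by (rule exI, (rule represents_intros)+)
  moreover have "\<exists>p. represents ((1 + var_a) * ((6*var_x + var_x^2 - 1) - (6 + 2*var_x) * var_a)) p"
    by (rule exI, (rule represents_intros)+)
  ultimately show spanned: "spanned (2 * var_x * (var_x^2 + 11*var_x - 1) * fps_deriv V)"
    unfolding ode_x by (blast intro: spanned_add spanned_mult spanned_represents spanned_V spanned_deriv_a)
  have "coef j (fps_deriv V) \<in> x_span" for j
  proof -
    have "poly_x [:0, - 2, 22, 2:] = 2 * var_x * (var_x^2 + 11*var_x - 1)"
      by (simp add: poly_x_simps power2_eq_square algebra_simps numeral_fps_const fps_const_neg
          flip: fls_const_numeral)
    then have "coef j (poly_x [:0, - 2, 22, 2:] * fps_deriv V) \<in> x_span"
      using spanned by (simp add: spanned_def coefs_spanned_def)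
    then show ?thesis unfolding coef_poly_x by (rule ratspan.cancel) simp
  qed
  then show "coefs_spanned (fps_deriv V)" by (simp only: coefs_spanned_def) blast
qed

lemma fps_deriv_basis: "b \<in> basis \<Longrightarrow> fps_deriv b \<in> x_span"
  using spanned_deriv_x by (auto simp: basis_def spanned_def coefs_spanned_def ratspan.zero)

lemma finite_basis: "finite basis"
  by (simp add: basis_def)

lemma x_span_d_finite: "f \<in> x_span \<Longrightarrow> d_finite f"
  unfolding d_finite_def
  by (rule x_series.ratspan_satisfies_linear_de[OF finite_basis fps_deriv_basis])

lemma xa_span_d_finite2:
  assumes "f \<in> xa_span"
  shows "d_finite2 f"
proof -
  have "fps_x (fps_deriv c) \<in> xa_span" if "c \<in> basis" for c
    using fps_x_in_xa_span[OF fps_deriv_basis[OF that]] .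
  then have "fps_deriv b \<in> xa_span" if "b \<in> insert (nonneg V) (fps_x ` basis)" for b
    using that spanned_deriv_x by (auto simp: spanned_def)
  moreover have "fps_deriv_inner b \<in> xa_span" if "b \<in> insert (nonneg V) (fps_x ` basis)" for b
    using that spanned_deriv_a by (auto simp: spanned_def ratspan.zero)
  moreover have "finite (insert (nonneg V) (fps_x ` basis))" by (simp add: finite_basis)
  ultimately show ?thesis
    unfolding d_finite2_def using assms
    by (blast intro: xa_series_x.ratspan_satisfies_linear_de xa_series_a.ratspan_satisfies_linear_de)
qed

end

section \<open>The diagonal series is D-finite\<close>

lemma sb_at_const:
  "sb_at (fps_const u) (fps_const v) = Abs_fps (\<lambda>n. sb_weight n u v)"
proof -
  have "sb_weight n (fps_const u) (fps_const v) = fps_const (sb_weight n u v)" for n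
    by (rule sb_weight_hom[symmetric]) simp_all
  then show ?thesis by (simp add: sb_at_def collapse_const)
qed

text \<open>
  \<open>S(1 + a, 1 + a)\<close> and \<open>S(1, 1 + 1/a)\<close> among the Laurent series.
\<close>

definition diagonal_series :: "rat fls fps" where
  "diagonal_series = Abs_fps (\<lambda>n. sb_weight n (1 + fls_X) (1 + fls_X))"

definition reflected_series :: "rat fls fps" where
  "reflected_series = Abs_fps (\<lambda>n. sb_weight n 1 (1 + fls_X_inv))"

lemma diagonal_series_nth:
  "fps_nth diagonal_series n = fps_to_fls (sb_weight n (1 + fps_X) (1 + fps_X))"
  unfolding diagonal_series_def
  by (simp add: sb_weight_hom[where f = fps_to_fls] fls_times_fps_to_fls)

lemma nonneg_diagonal_series: "nonneg diagonal_series = S_one_plus_a sb_series"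
  by (rule fps_ext) (simp add: diagonal_series_nth S_one_plus_a_sb_series)

lemma coef_0_diagonal_series: "coef 0 diagonal_series = S_one_one sb_series"
proof (rule fps_ext)
  fix n
  have "fps_nth (sb_weight n (1 + fps_X) (1 + fps_X)) 0 = sb_weight n 1 (1 :: rat)"
    by (subst sb_weight_hom[where f = "\<lambda>f. fps_nth f 0"]) simp_all
  then show "fps_nth (coef 0 diagonal_series) n = fps_nth (S_one_one sb_series) n"
    by (simp add: diagonal_series_nth S_one_one_def sb_series_def eval2_sb_weight)
qed

definition nonpositive :: "rat fls fps \<Rightarrow> bool" where
  "nonpositive f \<longleftrightarrow> (\<forall>j>0. coef j f = 0)"

lemma nonpositive_reflected_series: "nonpositive reflected_series"
proof -
  have pow: "fls_nth ((1 + fls_X_inv :: rat fls) ^ k) j = 0" if "j > 0" for k j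
    using that
    by (induction k arbitrary: j) (simp_all add: distrib_right fls_X_inv_times_conv_shift)
  have "fls_nth (sb_weight n 1 (1 + fls_X_inv :: rat fls)) j = 0" if "j > 0" for n j
    by (simp add: sb_weight_def fls_nth_sum pow that)
  then show ?thesis by (simp add: nonpositive_def fps_eq_iff reflected_series_def)
qed

lemma solve_for_diagonal:
  fixes a i x d r F :: "'r::comm_ring_1"
  assumes "a * i = 1" "a ^ 5 * d + a * x * (1 + a)^2 * r = F"
  shows "d = i * (i * (i * (i * (i * F)))) + i * (i * (- (x * (r + i * (r + r) + i * (i * r)))))"
proof -
  have "i ^ 5 * F = (a * i)^5 * d + i^2 * x * ((a * i) * i^2 + 2 * (a * i)^2 * i + (a * i)^3) * r"
    unfolding assms(2)[symmetric]
    by (simp add: algebra_simps power2_eq_square power3_eq_cube eval_nat_numeral)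
  also have "\<dots> = d + i^2 * x * (i^2 + 2 * i + 1) * r"
    unfolding assms(1) by simp
  finally show ?thesis
    by (simp add: algebra_simps power2_eq_square eval_nat_numeral)
qed

text \<open>
  The orbit relation divided by \<open>a^5\<close>. Its term with \<open>S(1, 1 + 1/a)\<close> has the factor
  \<open>x * (1 + a)^2 / a^4\<close>, so it involves only powers \<open>a^j\<close> with \<open>j \<le> -2\<close> and disappears in the nonnegative
  part.
\<close>

lemma diagonal_series_decomposition:
  assumes "kernel_root V"
  shows "\<exists>f g. kernel_root.spanned V f \<and> nonpositive g \<and>
    diagonal_series = f + fps_const fls_X_inv * (fps_const fls_X_inv * g)"
proof -
  interpret kernel_root V by fact
  let ?x = var_x and ?a = var_a and ?i = "fps_const fls_X_inv :: rat fls fps"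
  define q m where "q = ?x * (1 + ?a)" and "m = ?a - q * (1 + 2 * ?a)"
  have ai: "?a * ?i = 1"
    by (simp add: fls_X_times_conv_shift fls_X_inv_conv_shift_1)
  have inv: "inverse fls_X = (fls_X_inv :: rat fls)"
    by (rule inverse_unique) (simp add: fls_X_times_conv_shift fls_X_inv_conv_shift_1)
  have t: "fls_X \<noteq> (0 :: rat fls)" "1 + fls_X \<noteq> (0 :: rat fls)"
  proof -
    have "fls_nth (1 + fls_X :: rat fls) 0 \<noteq> 0" by simp
    then show "1 + fls_X \<noteq> (0 :: rat fls)" by (metis fls_zero_nth)
  qed simp
  have "V \<noteq> 0"
  proof
    assume "V = 0"
    then have "(1 + ?a) * ?a = 0" using V by simp
    then have "fps_nth ((1 + ?a) * ?a) 0 = 0" by simp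
    then show False using t by simp
  qed
  moreover have "1 + ?a \<noteq> 0"
  proof
    assume "1 + ?a = 0"
    then have "fps_nth (1 + ?a) 0 = 0" by simp
    then show False using t by simp
  qed
  ultimately have nz: "q * V \<noteq> 0" by (simp add: q_def)
  define F where "F = ?a ^ 5 * ?x * (1 + ?a)^2 - (?a^4 - 2*?a^3 + ?a^2 - 1) * q * ?a * (1 + ?a)
      - ?a * (1 - ?a) * m * ?a * (1 + ?a)
    + (q^2 * (1 + 2*?a^5) + q * m * (?a^4 - 2*?a^3 + ?a^2 - 1) + m^2 * ?a * (1 - ?a)
        - q^2 * ?a^2 * (1 + ?a) * (1 - ?a)) * V"
  have one: "1 + ?a = fps_const (1 + fls_X)" "1 + ?i = fps_const (1 + fls_X_inv)"
    by (simp_all flip: fps_const_1_eq_1)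
  have sb: "sb_at (1 + ?a) (1 + ?a) = diagonal_series" "sb_at 1 (1 + ?i) = reflected_series"
    using sb_at_const[of "1 + fls_X :: rat fls" "1 + fls_X"] sb_at_const[of "1 :: rat fls" "1 + fls_X_inv"]
    unfolding one diagonal_series_def reflected_series_def fps_const_1_eq_1 by blast+
  have rel: "?a ^ 5 * diagonal_series + ?a * ?x * (1 + ?a)^2 * reflected_series = F"
    using orbit_relation[of "fls_X :: rat fls" "q * V" V] t V nz
    unfolding F_def m_def q_def inv sb by simp
  have "\<exists>p. represents (?a ^ 5 * ?x * (1 + ?a)^2 - (?a^4 - 2*?a^3 + ?a^2 - 1) * q * ?a * (1 + ?a)
      - ?a * (1 - ?a) * m * ?a * (1 + ?a)) p"
    unfolding m_def q_def by (rule exI, (rule represents_intros)+)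
  moreover have "\<exists>p. represents (q^2 * (1 + 2*?a^5) + q * m * (?a^4 - 2*?a^3 + ?a^2 - 1) + m^2 * ?a * (1 - ?a)
        - q^2 * ?a^2 * (1 + ?a) * (1 - ?a)) p"
    unfolding m_def q_def by (rule exI, (rule represents_intros)+)
  ultimately have "spanned F"
    unfolding F_def by (blast intro: spanned_add spanned_mult spanned_represents spanned_V)
  then have spanned: "spanned (?i * (?i * (?i * (?i * (?i * F)))))" by (intro spanned_a_inverse)
  define g where "g = - (?x * (reflected_series + ?i * (reflected_series + reflected_series) + ?i * (?i * reflected_series)))"
  have "coef j g = 0" if "j > 0" for j
  proof -
    have "coef j reflected_series = 0" "coef (j + 1) reflected_series = 0"
      "coef (j + 1 + 1) reflected_series = 0"
      using nonpositive_reflected_series that by (simp_all add: nonpositive_def)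
    then show ?thesis unfolding g_def coef_simps by simp
  qed
  then have "nonpositive g" by (simp add: nonpositive_def)
  moreover have "diagonal_series = ?i * (?i * (?i * (?i * (?i * F)))) + ?i * (?i * g)"
    unfolding g_def by (rule solve_for_diagonal[OF ai rel])
  ultimately show ?thesis using spanned by blast
qed

theorem mainTheorem7:
  shows "(\<exists>!S. semi_baxter_equation S) \<and>
    (\<forall>S. semi_baxter_equation S \<longrightarrow>
       d_finite2 (S_one_plus_a S) \<and>
       S_one_one S = SB_gf \<and>
       d_finite (S_one_one S))"
proof -
  obtain V where "kernel_root V"
    using kernel_root_exists by (auto simp: kernel_root_def)
  then interpret kernel_root V .
  obtain f g where f: "spanned f" and g: "nonpositive g"
    and decomp: "diagonal_series = f + fps_const fls_X_inv * (fps_const fls_X_inv * g)"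
    using diagonal_series_decomposition[OF \<open>kernel_root V\<close>] by blast
  have coef: "coef j diagonal_series = coef j f" if "j \<ge> 0" for j
    using g that unfolding decomp by (simp add: nonpositive_def)
  have "nonneg diagonal_series = nonneg f"
  proof (rule fps_ext, rule fps_ext)
    fix n k
    show "fps_nth (fps_nth (nonneg diagonal_series) n) k = fps_nth (fps_nth (nonneg f) n) k"
      using arg_cong[OF coef[of "int k"], of "\<lambda>h. fps_nth h n"] by simp
  qed
  then have "S_one_plus_a sb_series \<in> xa_span"
    using f by (simp add: spanned_def flip: nonneg_diagonal_series)
  moreover have "S_one_one sb_series \<in> x_span"
    using f coef[of 0] by (simp add: spanned_def coefs_spanned_def flip: coef_0_diagonal_series)
  ultimately have "d_finite2 (S_one_plus_a sb_series)" "d_finite (S_one_one sb_series)"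
    using xa_span_d_finite2 x_span_d_finite by blast+
  moreover have "semi_baxter_equation S \<longleftrightarrow> S = sb_series" for S
    using semi_baxter_equation_sb_series semi_baxter_equation_unique by blast
  ultimately show ?thesis using S_one_one_sb_series by simp
qed

end
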